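(* The Bratteli diagram of $\mathfrak{I}$, relative to the increasing sequence of subalgebras $\mathfrak{B}_0\subset\mathfrak{B}_1\subset\mathfrak{B}_2\subset\cdots$ whose union is dense in $\mathfrak{I}$, is $$\overset{2}{\bullet}\rightrightarrows\overset{8}{\bullet}\rightrightarrows\cdots\rightrightarrows\overset{2^{2n+1}}{\bullet}\rightrightarrows\overset{2^{2n+3}}{\bullet}\rightrightarrows\cdots$$ That is, for every $n\ge 0$, $\mathfrak{B}_n\cong M_{2^{2n+1}}(\mathbb{C})$ and the (non-unital) inclusion $\mathfrak{B}_n\subset\mathfrak{B}_{n+1}$ is an embedding of multiplicity $2$.
   Context: $\mathfrak{B}$ is the universal unital $C^*$-algebra generated by elements $\{b_i : i\in\mathbb{Z}\}$ (with $b_i^\dagger:=b_i^*$) satisfying, for all $i,j\in\mathbb{Z}$, the monotone rules: (1) $b_ib_j=0$ if $i\le j$; (2) $b_ib_jb_j^\dagger=\alpha_{i,j}b_i$; (3) $b_i^\dagger b_i=b_{i-1}b_{i-1}^\dagger-b_ib_i^\dagger$; (4) $b_ib_i^\dagger b_j=b_j-\alpha_{i,j}\sum_{j<k\le i}b_k^\dagger b_kb_j$; where $\alpha_{i,j}=1$ if $i>j$ and $0$ otherwise. Equivalently, $\mathfrak{B}$ is identified, via $b_i\mapsto a_i$, with the unital $C^*$-algebra of operators generated by $\{a_i:i\in\mathbb{Z}\}$ on the monotone Fock space, i.e. the Hilbert space with orthonormal basis consisting of $\Omega$ and $e_{(i_1,\dots,i_k)}$ ($k\ge1$, $i_1<\cdots<i_k$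 integers), where $a_i\Omega=0$ and $a_ie_{(i_1,\dots,i_k)}=e_{(i_2,\dots,i_k)}$ if $i=i_1$ (this being $\Omega$ when $k=1$), and $0$ otherwise. $\mathfrak{I}$ is the $C^*$-subalgebra of $\mathfrak{B}$ generated by $\{b_i : i\in\mathbb{Z}\}$ without adjoining the unit of $\mathfrak{B}$, and $\mathfrak{B}_n:=C^*(\{b_i : |i|\le n\})\subset\mathfrak{I}$ is likewise generated without adjoining the unit. In the diagram, each bullet stands for the single full-matrix block of $\mathfrak{B}_n$, labelled by the matrix size, and the number of arrows between consecutive bullets is the multiplicity of the embedding: a $*$-homomorphism $M_p(\mathbb{C})\to M_q(\mathbb{C})$ has multiplicity $m$ if it is unitarily equivalent to $x\mapsto x\oplus\cdots\oplus x\oplus 0$ with $m$ copies of $x$ and a zero block of size $q-mp$. *)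

theory Defs
  imports "HOL-Analysis.Analysis" "Jordan_Normal_Form.Schur_Decomposition"
begin

typedef 'a ell2 = "{f :: 'a \<Rightarrow> complex. (\<lambda>a. (cmod (f a))\<^sup>2) summable_on UNIV}"
  morphisms coord Abs_ell2
  by (rule exI[of _ "\<lambda>_. 0"]) simp

setup_lifting type_definition_ell2

lemma ell2_ext: "x = y" if "\<And>a. coord x a = coord y a"
  using that by (simp add: coord_inject[symmetric] fun_eq_iff)

lemma square_summable_add:
  fixes f g :: "'a \<Rightarrow> complex"
  assumes "(\<lambda>a. (cmod (f a))\<^sup>2) summable_on UNIV" "(\<lambda>a. (cmod (g a))\<^sup>2) summable_on UNIV"
  shows "(\<lambda>a. (cmod (f a + g a))\<^sup>2) summable_on UNIV"
proof (rule summable_on_comparison_test)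
  show "(\<lambda>a. 2 * ((cmod (f a))\<^sup>2 + (cmod (g a))\<^sup>2)) summable_on UNIV"
    by (intro summable_on_cmult_right summable_on_add assms)
  fix a
  have "(cmod (f a + g a))\<^sup>2 \<le> (cmod (f a) + cmod (g a))\<^sup>2"
    by (intro power_mono norm_triangle_ineq) simp
  also have "\<dots> \<le> 2 * ((cmod (f a))\<^sup>2 + (cmod (g a))\<^sup>2)"
    using sum_squares_bound[of "cmod (f a)" "cmod (g a)"] by (simp add: power2_sum)
  finally show "(cmod (f a + g a))\<^sup>2 \<le> 2 * ((cmod (f a))\<^sup>2 + (cmod (g a))\<^sup>2)" .
qed simp

lemma square_summable_mult:
  fixes c :: complex
  assumes "(\<lambda>a. (cmod (f a))\<^sup>2) summable_on UNIV"
  shows "(\<lambda>a. (cmod (c * f a))\<^sup>2) summable_on UNIV"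
  using summable_on_cmult_right[OF assms, of "(cmod c)\<^sup>2"]
  by (simp add: norm_mult power_mult_distrib)

instantiation ell2 :: (type) real_vector
begin

lift_definition zero_ell2 :: "'a ell2" is "\<lambda>_. 0" by simp
lift_definition plus_ell2 :: "'a ell2 \<Rightarrow> 'a ell2 \<Rightarrow> 'a ell2" is "\<lambda>f g a. f a + g a"
  by (rule square_summable_add)
lift_definition uminus_ell2 :: "'a ell2 \<Rightarrow> 'a ell2" is "\<lambda>f a. - f a" by simp
lift_definition minus_ell2 :: "'a ell2 \<Rightarrow> 'a ell2 \<Rightarrow> 'a ell2" is "\<lambda>f g a. f a - g a"
  subgoal for f g using square_summable_add[of f "\<lambda>a. - g a"] by simp done
lift_definition scaleR_ell2 :: "real \<Rightarrow> 'a ell2 \<Rightarrow> 'a ell2" is "\<lambda>r f a. complex_of_real r * f a"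
  by (rule square_summable_mult)

instance
  by standard (transfer; simp add: fun_eq_iff algebra_simps)+

end

lift_definition scaleC_ell2 :: "complex \<Rightarrow> 'a ell2 \<Rightarrow> 'a ell2" (infixr \<open>*\<^sub>C\<close> 75)
  is "\<lambda>c f a. c * f a"
  by (rule square_summable_mult)

lemma coord_simps [simp]:
  "coord 0 a = 0" "coord (x + y) a = coord x a + coord y a" "coord (- x) a = - coord x a"
  "coord (x - y) a = coord x a - coord y a"
  "coord (r *\<^sub>R x) a = complex_of_real r * coord x a" "coord (c *\<^sub>C x) a = c * coord x a"
  by (transfer; simp)+

lemma coord_summable: "(\<lambda>a. (cmod (coord x a))\<^sup>2) summable_on UNIV"
  using coord[of x] by simp

lemma coord_mult_summable: "(\<lambda>a. cnj (coord x a) * coord y a) summable_on UNIV"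
proof (rule abs_summable_summable, rule summable_on_comparison_test)
  show "(\<lambda>a. (cmod (coord x a))\<^sup>2 + (cmod (coord y a))\<^sup>2) summable_on UNIV"
    by (intro summable_on_add coord_summable)
  fix a
  have "0 \<le> cmod (coord x a) * cmod (coord y a)" by simp
  thus "norm (cnj (coord x a) * coord y a) \<le> (cmod (coord x a))\<^sup>2 + (cmod (coord y a))\<^sup>2"
    using sum_squares_bound[of "cmod (coord x a)" "cmod (coord y a)"]
    unfolding norm_mult complex_mod_cnj by linarith
qed simp

text \<open>The complex inner product, antilinear in the first argument.\<close>

definition cinner :: "'a ell2 \<Rightarrow> 'a ell2 \<Rightarrow> complex" where
  "cinner x y = (\<Sum>\<^sub>\<infinity>a. cnj (coord x a) * coord y a)"

lemma cinner_add_left: "cinner (x + y) z = cinner x z + cinner y z"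
  unfolding cinner_def
  by (simp add: distrib_right infsum_add coord_mult_summable)

lemma cinner_scaleC_left: "cinner (c *\<^sub>C x) z = cnj c * cinner x z"
  unfolding cinner_def
  by (simp add: mult.assoc infsum_cmult_right' )

lemma cinner_commute: "cinner x y = cnj (cinner y x)"
  unfolding cinner_def infsum_cnj[symmetric] by (simp add: mult.commute)

lemma cinner_self: "cinner x x = complex_of_real (\<Sum>\<^sub>\<infinity>a. (cmod (coord x a))\<^sup>2)"
proof -
  have "((\<lambda>a. complex_of_real ((cmod (coord x a))\<^sup>2)) has_sum
          complex_of_real (\<Sum>\<^sub>\<infinity>a. (cmod (coord x a))\<^sup>2)) UNIV"
    by (intro has_sum_of_real has_sum_infsum coord_summable)
  hence "((\<lambda>a. cnj (coord x a) * coord x a) has_sum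
          complex_of_real (\<Sum>\<^sub>\<infinity>a. (cmod (coord x a))\<^sup>2)) UNIV"
    by (simp only: complex_norm_square mult.commute)
  thus ?thesis unfolding cinner_def by (rule infsumI)
qed

instantiation ell2 :: (type) real_inner
begin

definition inner_ell2 :: "'a ell2 \<Rightarrow> 'a ell2 \<Rightarrow> real" where
  "inner_ell2 x y = Re (cinner x y)"
definition norm_ell2 :: "'a ell2 \<Rightarrow> real" where
  "norm_ell2 x = sqrt (inner x x)"
definition sgn_ell2 :: "'a ell2 \<Rightarrow> 'a ell2" where
  "sgn_ell2 x = x /\<^sub>R norm x"
definition dist_ell2 :: "'a ell2 \<Rightarrow> 'a ell2 \<Rightarrow> real" where
  "dist_ell2 x y = norm (x - y)"
definition uniformity_ell2 :: "('a ell2 \<times> 'a ell2) filter" where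
  "uniformity_ell2 = (INF e\<in>{0<..}. principal {(x, y). dist x y < e})"
definition open_ell2 :: "'a ell2 set \<Rightarrow> bool" where
  "open_ell2 U \<longleftrightarrow> (\<forall>x\<in>U. \<forall>\<^sub>F (x', y) in uniformity. x' = x \<longrightarrow> y \<in> U)"

instance
proof
  fix x y z :: "'a ell2" and r :: real
  show "inner x y = inner y x"
    unfolding inner_ell2_def by (subst cinner_commute) simp
  show "inner (x + y) z = inner x z + inner y z"
    unfolding inner_ell2_def by (simp add: cinner_add_left)
  have "r *\<^sub>R x = complex_of_real r *\<^sub>C x" by (rule ell2_ext) simp
  thus "inner (r *\<^sub>R x) y = r * inner x y"
    unfolding inner_ell2_def by (simp add: cinner_scaleC_left)
  show "0 \<le> inner x x"
    unfolding inner_ell2_def cinner_self by (simp add: infsum_nonneg)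
  show "inner x x = 0 \<longleftrightarrow> x = 0"
  proof
    assume "inner x x = 0"
    hence s: "(\<Sum>\<^sub>\<infinity>a. (cmod (coord x a))\<^sup>2) = 0"
      unfolding inner_ell2_def cinner_self by simp
    have "(cmod (coord x a))\<^sup>2 = 0" for a
      using s by (rule nonneg_infsum_le_0D[OF eq_refl]) (auto simp: coord_summable)
    thus "x = 0" by (intro ell2_ext) simp
  next
    assume "x = 0"
    thus "inner x x = 0" by (simp add: inner_ell2_def cinner_self)
  qed
qed (simp_all add: norm_ell2_def sgn_ell2_def dist_ell2_def uniformity_ell2_def open_ell2_def)

end

lemma norm_ell2_square: "(norm x)\<^sup>2 = (\<Sum>\<^sub>\<infinity>a. (cmod (coord x a))\<^sup>2)"
  by (simp add: power2_norm_eq_inner inner_ell2_def cinner_self)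

lemma sum_coord_le: "finite F \<Longrightarrow> (\<Sum>a\<in>F. (cmod (coord x a))\<^sup>2) \<le> (norm x)\<^sup>2"
  unfolding norm_ell2_square by (rule finite_sum_le_infsum) (auto simp: coord_summable)

lemma norm_coord_le: "cmod (coord x a) \<le> norm x"
  using sum_coord_le[of "{a}" x] by (simp add: power2_le_iff_abs_le)

lemma norm_scaleC: "norm (c *\<^sub>C x) = cmod c * norm x"
proof -
  have "(norm (c *\<^sub>C x))\<^sup>2 = (cmod c * norm x)\<^sup>2"
    by (simp add: norm_ell2_square norm_mult power_mult_distrib infsum_cmult_right')
  thus ?thesis by (simp add: power2_eq_iff_nonneg)
qed

instance ell2 :: (type) banach
proof
  fix X :: "nat \<Rightarrow> 'a ell2"
  assume C: "Cauchy X"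
  have "Cauchy (\<lambda>n. coord (X n) a)" for a
    unfolding Cauchy_def
  proof (intro allI impI)
    fix e :: real assume "e > 0"
    then obtain M where M: "\<forall>m\<ge>M. \<forall>n\<ge>M. dist (X m) (X n) < e"
      using C unfolding Cauchy_def by blast
    have "dist (coord (X m) a) (coord (X n) a) \<le> dist (X m) (X n)" for m n
      using norm_coord_le[of "X m - X n" a] by (simp add: dist_norm)
    thus "\<exists>M. \<forall>m\<ge>M. \<forall>n\<ge>M. dist (coord (X m) a) (coord (X n) a) < e"
      using M by (meson le_less_trans)
  qed
  hence "\<exists>l. (\<lambda>n. coord (X n) a) \<longlonglongrightarrow> l" for a
    by (simp add: Cauchy_convergent_iff convergent_def)
  then obtain f where f: "\<And>a. (\<lambda>n. coord (X n) a) \<longlonglongrightarrow> f a" by metis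
  have bound: "(\<Sum>a\<in>F. (cmod (f a - coord (X n) a))\<^sup>2) \<le> e\<^sup>2"
    if F: "finite F" and e: "e > 0" and M: "\<And>m. m \<ge> M \<Longrightarrow> dist (X m) (X n) < e" for F n e M
  proof (rule LIMSEQ_le_const2)
    show "(\<lambda>m. \<Sum>a\<in>F. (cmod (coord (X m) a - coord (X n) a))\<^sup>2)
            \<longlonglongrightarrow> (\<Sum>a\<in>F. (cmod (f a - coord (X n) a))\<^sup>2)"
      by (intro tendsto_intros f)
    have "(\<Sum>a\<in>F. (cmod (coord (X m) a - coord (X n) a))\<^sup>2) \<le> e\<^sup>2" if "m \<ge> M" for m
    proof -
      have "(\<Sum>a\<in>F. (cmod (coord (X m) a - coord (X n) a))\<^sup>2) \<le> (norm (X m - X n))\<^sup>2"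
        using sum_coord_le[OF F, of "X m - X n"] by simp
      also have "\<dots> \<le> e\<^sup>2" using M[OF that] by (intro power_mono) (auto simp: dist_norm)
      finally show ?thesis .
    qed
    thus "\<exists>N. \<forall>m\<ge>N. (\<Sum>a\<in>F. (cmod (coord (X m) a - coord (X n) a))\<^sup>2) \<le> e\<^sup>2" by blast
  qed
  have diff: "(\<lambda>a. (cmod (f a - coord (X n) a))\<^sup>2) summable_on UNIV
      \<and> (\<Sum>\<^sub>\<infinity>a. (cmod (f a - coord (X n) a))\<^sup>2) \<le> e\<^sup>2"
    if "e > 0" and "\<And>m. m \<ge> M \<Longrightarrow> dist (X m) (X n) < e" for n e M
  proof
    show s: "(\<lambda>a. (cmod (f a - coord (X n) a))\<^sup>2) summable_on UNIV"
      by (rule nonneg_bdd_above_summable_on)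
         (use bound[OF _ that] in \<open>auto intro!: bdd_aboveI[of _ "e\<^sup>2"]\<close>)
    show "(\<Sum>\<^sub>\<infinity>a. (cmod (f a - coord (X n) a))\<^sup>2) \<le> e\<^sup>2"
      by (rule infsum_le_finite_sums[OF s]) (use bound[OF _ that] in auto)
  qed
  obtain M0 where M0: "\<forall>m\<ge>M0. \<forall>n\<ge>M0. dist (X m) (X n) < 1"
    using metric_CauchyD[OF C, of 1] by auto
  have "(\<lambda>a. (cmod (f a - coord (X M0) a))\<^sup>2) summable_on UNIV"
    using diff[of 1 M0 M0] M0 by simp
  from square_summable_add[OF this coord_summable[of "X M0"]]
  have "(\<lambda>a. (cmod (f a))\<^sup>2) summable_on UNIV" by simp
  hence cf: "coord (Abs_ell2 f) = f" by (simp add: Abs_ell2_inverse)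
  have "X \<longlonglongrightarrow> Abs_ell2 f"
    unfolding lim_sequentially
  proof (intro allI impI)
    fix e :: real assume e: "e > 0"
    then obtain M where M: "\<forall>m\<ge>M. \<forall>n\<ge>M. dist (X m) (X n) < e / 2"
      using C unfolding Cauchy_def by (meson half_gt_zero)
    have "dist (X n) (Abs_ell2 f) < e" if "n \<ge> M" for n
    proof -
      have "(norm (Abs_ell2 f - X n))\<^sup>2 \<le> (e / 2)\<^sup>2"
        using diff[of "e / 2" M n] M that e by (simp add: norm_ell2_square cf)
      hence "norm (Abs_ell2 f - X n) \<le> e / 2"
        using e by (simp add: power2_le_iff_abs_le)
      thus ?thesis using e by (simp add: dist_norm norm_minus_commute)
    qed
    thus "\<exists>M. \<forall>n\<ge>M. dist (X n) (Abs_ell2 f) < e" by blast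
  qed
  thus "convergent X" by (auto simp: convergent_def)
qed

lift_definition ket :: "'a \<Rightarrow> 'a ell2" is "\<lambda>a b. if b = a then 1 else 0"
  subgoal for a by (rule finite_nonzero_values_imp_summable_on) (auto intro: finite_subset[of _ "{a}"]) done

lemma cinner_ket: "cinner (ket a) (ket b) = (if a = b then 1 else 0)"
proof -
  have "cinner (ket a) (ket b) = (\<Sum>\<^sub>\<infinity>c\<in>{a}. if c = b then 1 else 0)"
    unfolding cinner_def by (rule infsum_cong_neutral) (auto simp: ket.rep_eq)
  thus ?thesis by simp
qed

text \<open>The type \<^typ>\<open>'a ell2 \<Rightarrow>\<^sub>L 'a ell2\<close> consists of the bounded \<^emph>\<open>real\<close>-linear operators,
  with the operator norm; complex linearity is imposed separately.\<close>

type_synonym 'a operator = "'a ell2 \<Rightarrow>\<^sub>L 'a ell2"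

definition complex_linear :: "'a operator \<Rightarrow> bool" where
  "complex_linear T \<longleftrightarrow> (\<forall>c x. blinfun_apply T (c *\<^sub>C x) = c *\<^sub>C blinfun_apply T x)"

lemma bounded_linear_scaleC: "bounded_linear (\<lambda>x :: 'a ell2. c *\<^sub>C x)"
proof (rule bounded_linear_intro[where K = "cmod c"])
  fix x y :: "'a ell2" and r :: real
  show "c *\<^sub>C (x + y) = c *\<^sub>C x + c *\<^sub>C y"
    by (rule ell2_ext) (simp add: distrib_left)
  show "c *\<^sub>C (r *\<^sub>R x) = r *\<^sub>R (c *\<^sub>C x)"
    by (rule ell2_ext) simp
  show "norm (c *\<^sub>C x) \<le> norm x * cmod c"
    by (simp add: norm_scaleC)
qed

definition scaleC_op :: "complex \<Rightarrow> 'a operator \<Rightarrow> 'a operator" where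
  "scaleC_op c T = Blinfun (\<lambda>x. c *\<^sub>C blinfun_apply T x)"

lemma scaleC_op_apply: "blinfun_apply (scaleC_op c T) x = c *\<^sub>C blinfun_apply T x"
  unfolding scaleC_op_def
  by (subst bounded_linear_Blinfun_apply)
     (auto intro: bounded_linear_compose[OF bounded_linear_scaleC] blinfun.bounded_linear_right)

definition is_adjoint :: "'a operator \<Rightarrow> 'a operator \<Rightarrow> bool" where
  "is_adjoint S T \<longleftrightarrow>
     (\<forall>x y. cinner (blinfun_apply T x) y = cinner x (blinfun_apply S y))"

text \<open>Concrete \<open>C\<^sup>*\<close>-algebras of operators; they need not contain the identity operator.\<close>

definition cstar_subalgebra :: "'a operator set \<Rightarrow> bool" where
  "cstar_subalgebra A \<longleftrightarrow>
     (\<forall>T\<in>A. complex_linear T) \<and> 0 \<in> A \<and>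
     (\<forall>S\<in>A. \<forall>T\<in>A. S + T \<in> A) \<and>
     (\<forall>c. \<forall>T\<in>A. scaleC_op c T \<in> A) \<and>
     (\<forall>S\<in>A. \<forall>T\<in>A. S o\<^sub>L T \<in> A) \<and>
     (\<forall>T\<in>A. \<exists>S\<in>A. is_adjoint S T) \<and>
     closed A"

definition cstar_generated :: "'a operator set \<Rightarrow> 'a operator set" where
  "cstar_generated X = \<Inter> {A. cstar_subalgebra A \<and> X \<subseteq> A}"

text \<open>Words \<open>(i\<^sub>1, \<dots>, i\<^sub>k)\<close> with \<open>i\<^sub>1 < \<cdots> < i\<^sub>k\<close>; the empty word indexes the vacuum.\<close>

typedef increasing_word = "{w :: int list. sorted_wrt (<) w}"
  morphisms letters word
  by (rule exI[of _ "[]"]) simp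

type_synonym monotone_fock = "increasing_word ell2"

definition vacuum :: monotone_fock (\<open>\<Omega>\<close>) where
  "\<Omega> = ket (word [])"

lemma square_summable_annihilator:
  fixes f :: "increasing_word \<Rightarrow> complex" and i :: int
  assumes f: "(\<lambda>w. (cmod (f w))\<^sup>2) summable_on (UNIV :: increasing_word set)"
  defines "g \<equiv> \<lambda>w. if sorted_wrt (<) (i # letters w) then f (word (i # letters w)) else 0"
  shows "(\<lambda>w. (cmod (g w))\<^sup>2) summable_on UNIV"
    and "(\<Sum>\<^sub>\<infinity>w. (cmod (g w))\<^sup>2) \<le> (\<Sum>\<^sub>\<infinity>w. (cmod (f w))\<^sup>2)"
proof -
  define W where "W = {w. sorted_wrt (<) (i # letters w)}"
  define h where "h = (\<lambda>w. word (i # letters w))"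
  have inj: "inj_on h W"
  proof (rule inj_onI)
    fix v w assume "v \<in> W" "w \<in> W" "h v = h w"
    hence "i # letters v = i # letters w"
      unfolding W_def h_def by (subst (asm) word_inject) auto
    thus "v = w" by (simp add: letters_inject)
  qed
  have "(\<lambda>w. (cmod (f w))\<^sup>2) summable_on h ` W"
    by (rule summable_on_subset_banach[OF f]) simp
  hence s: "(\<lambda>w. (cmod (f (h w)))\<^sup>2) summable_on W"
    by (simp add: summable_on_reindex[OF inj] o_def)
  show "(\<lambda>w. (cmod (g w))\<^sup>2) summable_on UNIV"
    using s by (rule summable_on_cong_neutral[THEN iffD1, rotated -1])
      (auto simp: g_def W_def h_def)
  have "(\<Sum>\<^sub>\<infinity>w. (cmod (g w))\<^sup>2) = (\<Sum>\<^sub>\<infinity>w\<in>W. (cmod (f (h w)))\<^sup>2)"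
    by (rule infsum_cong_neutral) (auto simp: g_def W_def h_def)
  also have "\<dots> = (\<Sum>\<^sub>\<infinity>w\<in>h ` W. (cmod (f w))\<^sup>2)"
    by (simp add: infsum_reindex[OF inj] o_def)
  also have "\<dots> \<le> (\<Sum>\<^sub>\<infinity>w. (cmod (f w))\<^sup>2)"
    by (rule infsum_mono_neutral[OF \<open>_ summable_on h ` W\<close> f]) auto
  finally show "(\<Sum>\<^sub>\<infinity>w. (cmod (g w))\<^sup>2) \<le> (\<Sum>\<^sub>\<infinity>w. (cmod (f w))\<^sup>2)" .
qed

lift_definition annihilator_fun :: "int \<Rightarrow> monotone_fock \<Rightarrow> monotone_fock" is
  "\<lambda>i f w. if sorted_wrt (<) (i # letters w) then f (word (i # letters w)) else 0"
  by (rule square_summable_annihilator(1))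

lemma norm_annihilator_fun: "norm (annihilator_fun i x) \<le> norm x"
proof -
  have "(norm (annihilator_fun i x))\<^sup>2 \<le> (norm x)\<^sup>2"
    unfolding norm_ell2_square annihilator_fun.rep_eq
    by (rule square_summable_annihilator(2)) (rule coord_summable)
  thus ?thesis by (rule power2_le_imp_le) simp
qed

text \<open>The bounded operator \<open>a\<^sub>i\<close>; its values on the orthonormal basis, which determine it, are
  computed in the lemmas that follow.\<close>

definition annihilator :: "int \<Rightarrow> increasing_word operator" where
  "annihilator i = Blinfun (annihilator_fun i)"

lemma annihilator_apply: "blinfun_apply (annihilator i) = annihilator_fun i"
  unfolding annihilator_def
proof (rule bounded_linear_Blinfun_apply, rule bounded_linear_intro[where K = 1])
  fix x y :: monotone_fock and r :: real
  show "annihilator_fun i (x + y) = annihilator_fun i x + annihilator_fun i y"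
    by (rule ell2_ext) (simp add: annihilator_fun.rep_eq)
  show "annihilator_fun i (r *\<^sub>R x) = r *\<^sub>R annihilator_fun i x"
    by (rule ell2_ext) (simp add: annihilator_fun.rep_eq)
  show "norm (annihilator_fun i x) \<le> norm x * 1"
    by (simp add: norm_annihilator_fun)
qed

lemma annihilator_vacuum: "blinfun_apply (annihilator i) \<Omega> = 0"
  by (rule ell2_ext)
     (auto simp: annihilator_apply annihilator_fun.rep_eq vacuum_def ket.rep_eq word_inject)

lemma annihilator_ket:
  assumes "sorted_wrt (<) (j # w)"
  shows "blinfun_apply (annihilator i) (ket (word (j # w))) = (if i = j then ket (word w) else 0)"
proof (rule ell2_ext)
  fix v
  have w: "sorted_wrt (<) w" using assms by simp
  have eq: "letters v = w \<longleftrightarrow> v = word w"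
    using w by (metis letters_inverse mem_Collect_eq word_inverse)
  have "word (i # letters v) = word (j # w) \<longleftrightarrow> i = j \<and> letters v = w"
    if "sorted_wrt (<) (i # letters v)"
    using that assms by (subst word_inject) auto
  thus "coord (blinfun_apply (annihilator i) (ket (word (j # w)))) v =
        coord (if i = j then ket (word w) else 0) v"
    using assms eq w
    by (auto simp: annihilator_apply annihilator_fun.rep_eq ket.rep_eq)
qed

lemma annihilator_complex_linear: "complex_linear (annihilator i)"
  unfolding complex_linear_def
  by (auto intro!: ell2_ext simp: annihilator_apply annihilator_fun.rep_eq)

text \<open>The universal unital \<open>C\<^sup>*\<close>-algebra of the monotone rules is realised on the monotone Fock
  space by \<open>b\<^sub>i \<mapsto> a\<^sub>i\<close>; the subalgebras below are generated without adjoining its unit.\<close>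

definition monotone_I :: "increasing_word operator set" (\<open>\<II>\<close>) where
  "\<II> = cstar_generated (range annihilator)"

definition monotone_B :: "nat \<Rightarrow> increasing_word operator set" (\<open>\<BB>\<close>) where
  "\<BB> n = cstar_generated (annihilator ` {i. \<bar>i\<bar> \<le> int n})"

text \<open>A \<open>*\<close>-isomorphism of \<open>A\<close> onto \<open>M\<^sub>d(\<complex>)\<close>.\<close>

definition matrix_isomorphism :: "'a operator set \<Rightarrow> nat \<Rightarrow> ('a operator \<Rightarrow> complex mat) \<Rightarrow> bool" where
  "matrix_isomorphism A d \<phi> \<longleftrightarrow>
     bij_betw \<phi> A (carrier_mat d d) \<and>
     (\<forall>S\<in>A. \<forall>T\<in>A. \<phi> (S + T) = \<phi> S + \<phi> T) \<and>
     (\<forall>c. \<forall>T\<in>A. \<phi> (scaleC_op c T) = c \<cdot>\<^sub>m \<phi> T) \<and>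
     (\<forall>S\<in>A. \<forall>T\<in>A. \<phi> (S o\<^sub>L T) = \<phi> S * \<phi> T) \<and>
     (\<forall>S\<in>A. \<forall>T\<in>A. is_adjoint S T \<longrightarrow> \<phi> S = mat_adjoint (\<phi> T))"

definition unitary_matrix :: "nat \<Rightarrow> complex mat \<Rightarrow> bool" where
  "unitary_matrix q U \<longleftrightarrow>
     U \<in> carrier_mat q q \<and> mat_adjoint U * U = 1\<^sub>m q \<and> U * mat_adjoint U = 1\<^sub>m q"

text \<open>A map \<open>M\<^sub>p \<rightarrow> M\<^sub>q\<close> unitarily equivalent to \<open>x \<mapsto> x \<oplus> \<cdots> \<oplus> x \<oplus> 0\<close> with \<open>m\<close> copies of \<open>x\<close>;
  such a map is automatically a \<open>*\<close>-homomorphism.\<close>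

definition has_multiplicity ::
    "nat \<Rightarrow> nat \<Rightarrow> nat \<Rightarrow> (complex mat \<Rightarrow> complex mat) \<Rightarrow> bool" where
  "has_multiplicity p q m f \<longleftrightarrow> m * p \<le> q \<and>
     (\<exists>U. unitary_matrix q U \<and>
       (\<forall>x\<in>carrier_mat p p.
          f x = U * diag_block_mat (replicate m x @ [0\<^sub>m (q - m * p) (q - m * p)]) * mat_adjoint U))"

text \<open>\<open>bratteli_single I A d m\<close>: relative to the increasing sequence \<open>A\<close> of subalgebras with dense
  union in \<open>I\<close>, the Bratteli diagram of \<open>I\<close> has at each level \<open>n\<close> exactly one bullet, labelled
  \<open>d n\<close>, joined to the next one by \<open>m n\<close> arrows.  The inclusion \<open>A n \<subseteq> A (n + 1)\<close>, read through
  the isomorphisms \<open>\<phi> n\<close>, is the matrix embedding whose multiplicity is counted.\<close>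

definition bratteli_single ::
    "'a operator set \<Rightarrow> (nat \<Rightarrow> 'a operator set) \<Rightarrow> (nat \<Rightarrow> nat) \<Rightarrow> (nat \<Rightarrow> nat) \<Rightarrow> bool" where
  "bratteli_single I A d m \<longleftrightarrow>
     cstar_subalgebra I \<and> (\<forall>n. cstar_subalgebra (A n)) \<and>
     (\<forall>n. A n \<subseteq> A (Suc n)) \<and>
     closure (\<Union>n. A n) = I \<and>
     (\<exists>\<phi>. (\<forall>n. matrix_isomorphism (A n) (d n) (\<phi> n)) \<and>
          (\<forall>n. has_multiplicity (d n) (d (Suc n)) (m n)
                 (\<lambda>x. \<phi> (Suc n) (inv_into (A n) (\<phi> n) x))))"

end

theory Submission
  imports Defs
begin

text \<open>Cut an increasing word at \<open>n\<close>: it is \<open>u y\<close> with the letters of \<open>u\<close> at most \<open>n\<close> and those of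
  \<open>y\<close> above \<open>n\<close>.  The \<open>a\<^sub>i\<close> with \<open>\<bar>i\<bar> \<le> n\<close> and their adjoints change only \<open>u\<close>, and they vanish as
  soon as \<open>u\<close> has a letter below \<open>-n\<close>.  So \<open>\<BB> n\<close> is spanned by the partial isometries
  \<open>E\<^sub>u\<^sub>v : e\<^sub>v\<^sub>y \<mapsto> e\<^sub>u\<^sub>y\<close> with \<open>u, v \<subseteq> {-n..n}\<close>, which are matrix units: \<open>a\<^sub>n a\<^sub>n\<^sup>*\<close> is the projection onto
  the words with empty \<open>u\<close>, and the creators \<open>a\<^sub>i\<^sup>*\<close> produce the other units from it.  At the next
  level the letter \<open>n + 1\<close> is either absent from \<open>y\<close> or its first letter, so \<open>E\<^sub>u\<^sub>v\<close> becomes the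
  sum of the unit for \<open>u, v\<close> and the unit for \<open>u (n + 1), v (n + 1)\<close>; this is the multiplicity 2.\<close>

section \<open>Operators permuting basis vectors\<close>

text \<open>Coefficients are pulled back along \<open>h\<close>: if \<open>h w = Some v\<close>, the
  basis vector at \<open>v\<close> goes to the one at \<open>w\<close>, so basis vectors move by the
  inverse of \<open>h\<close>. Injectivity of \<open>h\<close> on its domain, assumed in the lemmas,
  guarantees that this is a bounded operator.\<close>

definition relabel :: "('a \<Rightarrow> 'a option) \<Rightarrow> 'a operator" where
  "relabel h = Blinfun (\<lambda>x. Abs_ell2 (\<lambda>w. case h w of None \<Rightarrow> 0 | Some v \<Rightarrow> coord x v))"

text \<open>By injectivity the nonzero entries of \<open>g\<close> are a subfamily of those of
  \<open>f\<close>, each taken at most once.\<close>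

lemma square_summable_relabel:
  fixes f :: "'a \<Rightarrow> complex"
  assumes inj: "inj_on h (dom h)" and f: "(\<lambda>w. (cmod (f w))\<^sup>2) summable_on UNIV"
  defines "g \<equiv> \<lambda>w. case h w of None \<Rightarrow> 0 | Some v \<Rightarrow> f v"
  shows "(\<lambda>w. (cmod (g w))\<^sup>2) summable_on UNIV"
    and "(\<Sum>\<^sub>\<infinity>w. (cmod (g w))\<^sup>2) \<le> (\<Sum>\<^sub>\<infinity>w. (cmod (f w))\<^sup>2)"
proof -
  define k where "k = (\<lambda>w. the (h w))"
  have ik: "inj_on k (dom h)"
    using inj by (auto simp: inj_on_def k_def dom_def)
  have sub: "(\<lambda>w. (cmod (f w))\<^sup>2) summable_on k ` dom h"
    by (rule summable_on_subset_banach[OF f]) simp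
  hence s: "(\<lambda>w. (cmod (f (k w)))\<^sup>2) summable_on dom h"
    by (simp add: summable_on_reindex[OF ik] o_def)
  show "(\<lambda>w. (cmod (g w))\<^sup>2) summable_on UNIV"
    using s by (rule summable_on_cong_neutral[THEN iffD1, rotated -1])
      (auto simp: g_def k_def split: option.splits)
  have "(\<Sum>\<^sub>\<infinity>w. (cmod (g w))\<^sup>2) = (\<Sum>\<^sub>\<infinity>w\<in>dom h. (cmod (f (k w)))\<^sup>2)"
    by (rule infsum_cong_neutral) (auto simp: g_def k_def split: option.splits)
  also have "\<dots> = (\<Sum>\<^sub>\<infinity>w\<in>k ` dom h. (cmod (f w))\<^sup>2)"
    by (simp add: infsum_reindex[OF ik] o_def)
  also have "\<dots> \<le> (\<Sum>\<^sub>\<infinity>w. (cmod (f w))\<^sup>2)"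
    by (rule infsum_mono_neutral[OF sub f]) auto
  finally show "(\<Sum>\<^sub>\<infinity>w. (cmod (g w))\<^sup>2) \<le> (\<Sum>\<^sub>\<infinity>w. (cmod (f w))\<^sup>2)" .
qed

lemma coord_relabel:
  assumes inj: "inj_on h (dom h)"
  shows "coord (blinfun_apply (relabel h) x) w = (case h w of None \<Rightarrow> 0 | Some v \<Rightarrow> coord x v)"
proof -
  define F where "F = (\<lambda>x. Abs_ell2 (\<lambda>w. case h w of None \<Rightarrow> 0 | Some v \<Rightarrow> coord x v))"
  have F: "coord (F x) = (\<lambda>w. case h w of None \<Rightarrow> 0 | Some v \<Rightarrow> coord x v)" for x
    unfolding F_def using square_summable_relabel(1)[OF inj coord_summable[of x]]
    by (simp add: Abs_ell2_inverse)
  have "bounded_linear F"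
  proof (rule bounded_linear_intro[where K = 1])
    fix x y :: "'a ell2" and r :: real
    show "F (x + y) = F x + F y" "F (r *\<^sub>R x) = r *\<^sub>R F x"
      by (auto intro!: ell2_ext simp: F split: option.splits)
    have "(norm (F x))\<^sup>2 \<le> (norm x)\<^sup>2"
      unfolding norm_ell2_square F
      by (rule square_summable_relabel(2)[OF inj coord_summable])
    thus "norm (F x) \<le> norm x * 1"
      using power2_le_imp_le by fastforce
  qed
  hence "blinfun_apply (relabel h) = F"
    unfolding relabel_def F_def by (rule bounded_linear_Blinfun_apply)
  thus ?thesis by (simp add: F)
qed

text \<open>The hypothesis makes \<open>h\<close> and \<open>g\<close> mutually inverse partial
  maps; it is symmetric in the two, so it yields injectivity of \<open>g\<close> as well.\<close>

lemma inj_on_dom_partial_inverse: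
  assumes "\<And>v w. h w = Some v \<longleftrightarrow> g v = Some w"
  shows "inj_on h (dom h)"
  using assms by (intro inj_onI) (auto simp: dom_def, metis option.inject)

text \<open>Both inner products are the same sum over the pairs \<open>(v, w)\<close> with
  \<open>h w = Some v\<close>, indexed once by \<open>w\<close> and once by
  \<open>v\<close>.\<close>

lemma is_adjoint_relabel:
  assumes gh: "\<And>v w. h w = Some v \<longleftrightarrow> g v = Some w"
  shows "is_adjoint (relabel g) (relabel h)"
  unfolding is_adjoint_def
proof (intro allI)
  fix x y
  have ih: "inj_on h (dom h)" and ig: "inj_on g (dom g)"
    using inj_on_dom_partial_inverse[of h g] inj_on_dom_partial_inverse[of g h] gh by auto
  have hg: "g v = Some w" if "h w = Some v" for v w using gh that by blast
  have gh': "h w = Some v" if "g v = Some w" for v w using gh that by blast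
  have bij: "bij_betw (\<lambda>v. the (g v)) (dom g) (dom h)"
  proof (rule bij_betw_byWitness[where f' = "\<lambda>w. the (h w)"])
    show "\<forall>v\<in>dom g. the (h (the (g v))) = v" "\<forall>w\<in>dom h. the (g (the (h w))) = w"
      using gh by force+
    show "(\<lambda>v. the (g v)) ` dom g \<subseteq> dom h"
      by (rule image_subsetI) (metis domD domI gh' option.sel)
    show "(\<lambda>w. the (h w)) ` dom h \<subseteq> dom g"
      by (rule image_subsetI) (metis domD domI hg option.sel)
  qed
  have "cinner (blinfun_apply (relabel h) x) y
      = (\<Sum>\<^sub>\<infinity>w\<in>dom h. cnj (coord x (the (h w))) * coord y w)"
    unfolding cinner_def coord_relabel[OF ih]
    by (rule infsum_cong_neutral) (auto split: option.splits)
  also have "\<dots> = (\<Sum>\<^sub>\<infinity>v\<in>dom g. cnj (coord x (the (h (the (g v))))) * coord y (the (g v)))"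
    by (rule infsum_reindex_bij_betw[OF bij, symmetric])
  also have "\<dots> = (\<Sum>\<^sub>\<infinity>v\<in>dom g. cnj (coord x v) * coord y (the (g v)))"
    by (rule infsum_cong) (use gh in force)
  also have "\<dots> = cinner x (blinfun_apply (relabel g) y)"
    unfolding cinner_def coord_relabel[OF ig]
    by (rule infsum_cong_neutral) (auto split: option.splits)
  finally show "cinner (blinfun_apply (relabel h) x) y = cinner x (blinfun_apply (relabel g) y)" .
qed

lemma complex_linear_relabel: "inj_on h (dom h) \<Longrightarrow> complex_linear (relabel h)"
  unfolding complex_linear_def
  by (auto intro!: ell2_ext simp: coord_relabel split: option.splits)

section \<open>Adjoints and closures of \<open>*\<close>-algebras\<close>

lemma cinner_add_right: "cinner x (y + z) = cinner x y + cinner x z"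
  using cinner_add_left[of y z x] by (metis cinner_commute complex_cnj_add)

lemma cinner_scaleC_right: "cinner x (c *\<^sub>C y) = c * cinner x y"
  using cinner_scaleC_left[of c y x] by (metis cinner_commute complex_cnj_cnj complex_cnj_mult)

text \<open>Reduces the complex inner product to the real one, from which
  \<open>tendsto_cinner\<close> inherits continuity.\<close>

lemma cinner_inner:
  "cinner x y = complex_of_real (inner x y) + \<i> * complex_of_real (inner (\<i> *\<^sub>C x) y)"
  by (simp add: complex_eq_iff inner_ell2_def cinner_scaleC_left)

lemma tendsto_cinner:
  assumes "(f \<longlongrightarrow> x) F" "(g \<longlongrightarrow> y) F"
  shows "((\<lambda>k. cinner (f k) (g k)) \<longlongrightarrow> cinner x y) F"
  unfolding cinner_inner
  by (intro tendsto_intros assms bounded_linear.tendsto[OF bounded_linear_scaleC])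

lemma is_adjoint_unique:
  assumes "is_adjoint S T" "is_adjoint S' T"
  shows "S = S'"
proof (rule blinfun_eqI)
  fix y
  let ?z = "blinfun_apply S y - blinfun_apply S' y"
  have "cinner ?z (blinfun_apply S y) = cinner ?z (blinfun_apply S' y)"
    using assms unfolding is_adjoint_def by metis
  hence "inner ?z ?z = 0"
    by (simp add: inner_diff_right) (simp add: inner_ell2_def)
  thus "blinfun_apply S y = blinfun_apply S' y" by simp
qed

lemma is_adjoint_zero: "is_adjoint 0 0"
  by (simp add: is_adjoint_def cinner_def)

lemma is_adjoint_add: "is_adjoint S T \<Longrightarrow> is_adjoint S' T' \<Longrightarrow> is_adjoint (S + S') (T + T')"
  by (simp add: is_adjoint_def blinfun.add_left cinner_add_left cinner_add_right)

lemma is_adjoint_scaleC: "is_adjoint S T \<Longrightarrow> is_adjoint (scaleC_op (cnj c) S) (scaleC_op c T)"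
  by (simp add: is_adjoint_def scaleC_op_apply cinner_scaleC_left cinner_scaleC_right)

lemma scaleC_op_minus_one: "scaleC_op (-1) T = - T"
  by (rule blinfun_eqI, rule ell2_ext) (simp add: scaleC_op_apply blinfun.minus_left)

lemma is_adjoint_diff: "is_adjoint S T \<Longrightarrow> is_adjoint S' T' \<Longrightarrow> is_adjoint (S - S') (T - T')"
  using is_adjoint_add[of S T "- S'" "- T'"] is_adjoint_scaleC[of S' T' "-1"]
  by (simp add: scaleC_op_minus_one)

lemma is_adjoint_sum:
  "(\<And>k. k \<in> K \<Longrightarrow> is_adjoint (S k) (T k)) \<Longrightarrow> is_adjoint (\<Sum>k\<in>K. S k) (\<Sum>k\<in>K. T k)"
  by (induction K rule: infinite_finite_induct) (auto simp: is_adjoint_zero is_adjoint_add)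

text \<open>For s = S y one has |s|^2 = <T s, y> \<le> |T| |s| |y|, and |s| cancels. Applied to
  differences, this makes passing to adjoints continuous.\<close>

lemma norm_adjoint_le:
  assumes "is_adjoint S T"
  shows "norm S \<le> norm T"
proof (rule norm_blinfun_bound)
  fix y
  let ?s = "blinfun_apply S y"
  have "(norm ?s)\<^sup>2 = inner (blinfun_apply T ?s) y"
    using assms by (simp add: power2_norm_eq_inner inner_ell2_def is_adjoint_def)
  also have "\<dots> \<le> norm (blinfun_apply T ?s) * norm y"
    by (rule norm_cauchy_schwarz)
  also have "\<dots> \<le> norm T * norm ?s * norm y"
    by (intro mult_right_mono norm_blinfun) simp
  finally have "norm ?s * norm ?s \<le> norm ?s * (norm T * norm y)"
    by (simp add: power2_eq_square mult_ac)
  thus "norm ?s \<le> norm T * norm y"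
    by (cases "norm ?s = 0") (auto simp: mult_le_cancel_left)
qed simp

text \<open>The operator type imposes real linearity only, so complex linearity has to be carried
  through limits separately.\<close>

lemma complex_linear_closure:
  assumes "\<forall>T\<in>A. complex_linear T" "T \<in> closure A"
  shows "complex_linear T"
proof -
  obtain X where X: "\<And>k. X k \<in> A" "X \<longlonglongrightarrow> T"
    using assms(2) unfolding closure_sequential by blast
  have "blinfun_apply T (c *\<^sub>C x) = c *\<^sub>C blinfun_apply T x" for c x
  proof (rule LIMSEQ_unique)
    show "(\<lambda>k. blinfun_apply (X k) (c *\<^sub>C x)) \<longlonglongrightarrow> blinfun_apply T (c *\<^sub>C x)"
      by (intro blinfun.tendsto X tendsto_const)
    have "blinfun_apply (X k) (c *\<^sub>C x) = c *\<^sub>C blinfun_apply (X k) x" for k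
      using assms(1) X(1) by (auto simp: complex_linear_def)
    thus "(\<lambda>k. blinfun_apply (X k) (c *\<^sub>C x)) \<longlonglongrightarrow> c *\<^sub>C blinfun_apply T x"
      by (simp, intro bounded_linear.tendsto[OF bounded_linear_scaleC] blinfun.tendsto X tendsto_const)
  qed
  thus ?thesis by (simp add: complex_linear_def)
qed

text \<open>The adjoints of an approximating sequence are again Cauchy by
  \<open>norm_adjoint_le\<close>; completeness gives a limit, and continuity of
  \<open>cinner\<close> identifies it as the adjoint of \<open>T\<close>.\<close>

lemma adjoint_closure:
  assumes "\<forall>T\<in>A. \<exists>S\<in>A. is_adjoint S T" "T \<in> closure A"
  shows "\<exists>S\<in>closure A. is_adjoint S T"
proof -
  obtain X where X: "\<And>k. X k \<in> A" "X \<longlonglongrightarrow> T"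
    using assms(2) unfolding closure_sequential by blast
  obtain Y where Y: "\<And>k. Y k \<in> A" "\<And>k. is_adjoint (Y k) (X k)"
  proof -
    have "\<forall>k. \<exists>S. S \<in> A \<and> is_adjoint S (X k)" using assms(1) X(1) by blast
    from choice[OF this] show thesis using that by blast
  qed
  have "Cauchy Y"
  proof (rule metric_CauchyI)
    fix e :: real assume "e > 0"
    then obtain M where "\<forall>m\<ge>M. \<forall>n\<ge>M. dist (X m) (X n) < e"
      using LIMSEQ_imp_Cauchy[OF X(2)] unfolding Cauchy_def by blast
    moreover have "dist (Y m) (Y n) \<le> dist (X m) (X n)" for m n
      unfolding dist_norm by (intro norm_adjoint_le is_adjoint_diff Y)
    ultimately show "\<exists>M. \<forall>m\<ge>M. \<forall>n\<ge>M. dist (Y m) (Y n) < e"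
      by (meson le_less_trans)
  qed
  then obtain S where S: "Y \<longlonglongrightarrow> S"
    using Cauchy_convergent_iff convergent_def by blast
  have "cinner (blinfun_apply T x) y = cinner x (blinfun_apply S y)" for x y
  proof (rule LIMSEQ_unique)
    show "(\<lambda>k. cinner (blinfun_apply (X k) x) y) \<longlonglongrightarrow> cinner (blinfun_apply T x) y"
      by (intro tendsto_cinner blinfun.tendsto X tendsto_const)
    have "(\<lambda>k. cinner x (blinfun_apply (Y k) y)) \<longlonglongrightarrow> cinner x (blinfun_apply S y)"
      by (intro tendsto_cinner blinfun.tendsto S tendsto_const)
    thus "(\<lambda>k. cinner (blinfun_apply (X k) x) y) \<longlonglongrightarrow> cinner x (blinfun_apply S y)"
      using Y(2) by (simp add: is_adjoint_def)
  qed
  thus ?thesis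
    using S Y(1) by (intro bexI[of _ S]) (auto simp: is_adjoint_def closure_sequential)
qed

lemma bounded_linear_scaleC_op: "bounded_linear (scaleC_op c)"
proof (rule bounded_linear_intro[where K = "cmod c"])
  fix S T :: "'a operator" and r :: real
  show "scaleC_op c (S + T) = scaleC_op c S + scaleC_op c T"
    by (rule blinfun_eqI, rule ell2_ext) (simp add: scaleC_op_apply blinfun.add_left distrib_left)
  show "scaleC_op c (r *\<^sub>R S) = r *\<^sub>R scaleC_op c S"
    by (rule blinfun_eqI, rule ell2_ext) (simp add: scaleC_op_apply blinfun.scaleR_left)
  show "norm (scaleC_op c S) \<le> norm S * cmod c"
  proof (rule norm_blinfun_bound)
    fix x
    have "cmod c * norm (blinfun_apply S x) \<le> cmod c * (norm S * norm x)"
      by (intro mult_left_mono norm_blinfun) simp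
    thus "norm (blinfun_apply (scaleC_op c S) x) \<le> norm S * cmod c * norm x"
      by (simp add: scaleC_op_apply norm_scaleC mult_ac)
  qed simp
qed

text \<open>Each operation is continuous and so extends to limits of sequences in \<open>A\<close>.
  It will be applied to the union of the \<open>\<BB> n\<close>.\<close>

lemma cstar_subalgebra_closure:
  assumes "\<forall>T\<in>A. complex_linear T" "0 \<in> A"
    and "\<forall>S\<in>A. \<forall>T\<in>A. S + T \<in> A"
    and "\<forall>c. \<forall>T\<in>A. scaleC_op c T \<in> A"
    and "\<forall>S\<in>A. \<forall>T\<in>A. S o\<^sub>L T \<in> A"
    and "\<forall>T\<in>A. \<exists>S\<in>A. is_adjoint S T"
  shows "cstar_subalgebra (closure A)"
  unfolding cstar_subalgebra_def
proof (intro conjI ballI allI)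
  show "complex_linear T" if "T \<in> closure A" for T
    using complex_linear_closure assms(1) that by blast
  show "0 \<in> closure A" using assms(2) closure_subset by blast
  show "\<exists>S\<in>closure A. is_adjoint S T" if "T \<in> closure A" for T
    using adjoint_closure assms(6) that by blast
  show "scaleC_op c T \<in> closure A" if T: "T \<in> closure A" for c T
  proof -
    obtain X where X: "\<And>k. X k \<in> A" "X \<longlonglongrightarrow> T"
      using T unfolding closure_sequential by blast
    have "(\<lambda>k. scaleC_op c (X k)) \<longlonglongrightarrow> scaleC_op c T"
      by (rule bounded_linear.tendsto[OF bounded_linear_scaleC_op X(2)])
    thus ?thesis
      unfolding closure_sequential using X(1) assms(4) by (intro exI[of _ "\<lambda>k. scaleC_op c (X k)"]) auto
  qed
  fix S T assume "S \<in> closure A" "T \<in> closure A"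
  then obtain X Y where X: "\<And>k. X k \<in> A" "X \<longlonglongrightarrow> S" and Y: "\<And>k. Y k \<in> A" "Y \<longlonglongrightarrow> T"
    unfolding closure_sequential by metis
  have "(\<lambda>k. X k + Y k) \<longlonglongrightarrow> S + T" "(\<lambda>k. X k o\<^sub>L Y k) \<longlonglongrightarrow> (S o\<^sub>L T)"
    using X Y by (auto intro!: tendsto_intros bounded_bilinear.tendsto[OF bounded_bilinear_blinfun_compose])
  thus "S + T \<in> closure A" "S o\<^sub>L T \<in> closure A"
    unfolding closure_sequential using X(1) Y(1) assms(3,5)
    by (metis (no_types, lifting))+
qed simp

section \<open>Matrix units on the monotone Fock space\<close>

text \<open>The order of the list is chosen so that the inclusion of level \<open>n\<close> into level \<open>n + 1\<close> is
  literally \<open>x \<mapsto> x \<oplus> x \<oplus> 0\<close>, with no unitary conjugation.\<close>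

fun block_words :: "nat \<Rightarrow> int list list" where
  "block_words 0 = [[], [0]]"
| "block_words (Suc n) =
     block_words n @ map (\<lambda>u. u @ [int n + 1]) (block_words n)
     @ map (\<lambda>u. (- int n - 1) # u) (block_words n)
     @ map (\<lambda>u. (- int n - 1) # u @ [int n + 1]) (block_words n)"

lemma length_block_words: "length (block_words n) = 2 ^ (2 * n + 1)"
  by (induction n) auto

text \<open>A word over the enlarged alphabet contains or omits each of the new extreme letters
  \<open>- int n - 1\<close> and \<open>int n + 1\<close>; the four combinations are the four parts
  of the recursion.\<close>

lemma set_block_words: "set (block_words n) = {u. sorted_wrt (<) u \<and> set u \<subseteq> {- int n..int n}}"
proof (induction n)
  case 0
  have "u \<in> {[], [0]}" if u: "sorted_wrt (<) u" "set u \<subseteq> {0::int}" for u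
  proof (cases "set u = {}")
    case False
    hence "set u = {0}" using u(2) by (simp add: subset_singleton_iff)
    thus ?thesis using u(1) strict_sorted_equal[of "[0]" u] by auto
  qed simp
  thus ?case by auto
next
  case (Suc n)
  let ?N = "int n + 1"
  show ?case
  proof (rule subset_antisym; rule subsetI)
    fix u assume "u \<in> set (block_words (Suc n))"
    then obtain v where v: "v \<in> set (block_words n)"
      and u: "u = v \<or> u = v @ [?N] \<or> u = (- int n - 1) # v \<or> u = (- int n - 1) # v @ [?N]"
      by auto
    have "sorted_wrt (<) v" "\<forall>k\<in>set v. - int n \<le> k \<and> k \<le> int n"
      using v Suc.IH by auto
    thus "u \<in> {u. sorted_wrt (<) u \<and> set u \<subseteq> {- int (Suc n)..int (Suc n)}}"
      using u by (elim disjE) (force simp: sorted_wrt_append)+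
  next
    fix u assume "u \<in> {u. sorted_wrt (<) u \<and> set u \<subseteq> {- int (Suc n)..int (Suc n)}}"
    hence s: "sorted_wrt (<) u" and r: "\<And>k. k \<in> set u \<Longrightarrow> - int n - 1 \<le> k \<and> k \<le> ?N"
      by force+
    define v where "v = filter (\<lambda>k. - int n \<le> k \<and> k \<le> int n) u"
    have v: "v \<in> set (block_words n)"
      using s unfolding Suc.IH by (auto simp: v_def sorted_wrt_filter)
    have sv: "sorted_wrt (<) v" "\<And>k. k \<in> set v \<Longrightarrow> - int n \<le> k \<and> k \<le> int n"
      using v Suc.IH by auto
    \<comment> \<open>The extreme letters are put back around the middle part of \<open>u\<close>.
      Being increasing with the same letters, \<open>w\<close> must equal \<open>u\<close>, and its
      shape exhibits the part it belongs to.\<close>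
    define w where "w = (if - int n - 1 \<in> set u then [- int n - 1] else []) @ v
      @ (if ?N \<in> set u then [?N] else [])"
    have "sorted_wrt (<) w"
      using sv unfolding w_def by (force simp: sorted_wrt_append)
    moreover have "k \<in> set w \<longleftrightarrow> k \<in> set u" for k
      using r[of k] by (cases "k = ?N"; cases "k = - int n - 1") (auto simp: w_def v_def)
    hence "set w = set u" by blast
    ultimately have "u = w" using s strict_sorted_equal by metis
    moreover have "w \<in> set (block_words (Suc n))"
      using v by (auto simp: w_def)
    ultimately show "u \<in> set (block_words (Suc n))" by (simp only:)
  qed
qed

lemma block_wordsD:
  assumes "u \<in> set (block_words n)"
  shows "sorted_wrt (<) u" "\<And>k. k \<in> set u \<Longrightarrow> k \<le> int n" "\<And>k. k \<in> set u \<Longrightarrow> - int n \<le> k"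
  using assms by (auto simp: set_block_words)

lemma Nil_in_block_words: "[] \<in> set (block_words n)"
  by (simp add: set_block_words)

lemma distinct_block_words: "distinct (block_words n)"
proof (induction n)
  case (Suc n)
  \<comment> \<open>The new letters do not occur in words of level \<open>n\<close>, which separates
    the four parts.\<close>
  have new: "int n + 1 \<notin> set u" "- int n - 1 \<notin> set u" if "u \<in> set (block_words n)" for u
    using block_wordsD(2,3)[OF that] by force+
  have "u @ [int n + 1] \<noteq> (- int n - 1) # v" "u \<noteq> v @ [int n + 1]" "u \<noteq> (- int n - 1) # v"
    if "u \<in> set (block_words n)" for u v
    using new[OF that] by (cases u; auto)+
  thus ?case using Suc
    by (auto simp: distinct_map inj_on_def) (metis append_Cons)+
qed simp

lemma word_decomposition:
  obtains u y where "w = word (u @ y)" "sorted_wrt (<) (u @ y)"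
    "\<forall>k\<in>set u. k \<le> m" "\<forall>k\<in>set y. m < k"
proof
  let ?l = "letters w"
  have s: "sorted_wrt (<) ?l" using letters[of w] by simp
  show "w = word (takeWhile (\<lambda>k. k \<le> m) ?l @ dropWhile (\<lambda>k. k \<le> m) ?l)"
    by (simp add: letters_inverse)
  show "sorted_wrt (<) (takeWhile (\<lambda>k. k \<le> m) ?l @ dropWhile (\<lambda>k. k \<le> m) ?l)"
    using s by simp
  show "\<forall>k\<in>set (takeWhile (\<lambda>k. k \<le> m) ?l). k \<le> m"
    by (auto dest: set_takeWhileD)
  \<comment> \<open>In an increasing list, all letters from the first one above \<open>m\<close>
    onwards exceed \<open>m\<close>.\<close>
  have "sorted_wrt (<) l \<Longrightarrow> \<forall>k\<in>set (dropWhile (\<lambda>k. k \<le> m) l). m < k" for l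
    by (induction l) auto
  thus "\<forall>k\<in>set (dropWhile (\<lambda>k. k \<le> m) ?l). m < k" using s by blast
qed

section \<open>Exchange of prefixes and the matrix units\<close>

lemma letters_word: "sorted_wrt (<) l \<Longrightarrow> letters (word l) = l"
  by (simp add: word_inverse)

lemma word_eq_iff: "sorted_wrt (<) l \<Longrightarrow> sorted_wrt (<) l' \<Longrightarrow> word l = word l' \<longleftrightarrow> l = l'"
  by (simp add: word_inject)

lemma sorted_block_append:
  assumes "u \<in> set (block_words n)" "sorted_wrt (<) y" "\<forall>k\<in>set y. int n < k"
  shows "sorted_wrt (<) (u @ y)"
  using assms block_wordsD(1,2)[OF assms(1)] by (fastforce simp: sorted_wrt_append)

text \<open>Since \<open>relabel\<close> pulls back, trading \<open>u\<close> for \<open>v\<close>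
  yields the operator \<open>e_vy -> e_uy\<close>. Cutting from above only is enough: a prefix with
  a letter below \<open>- int n\<close> differs from every block word \<open>u\<close> and is sent
  to \<open>None\<close>.\<close>

definition swap_prefix :: "nat \<Rightarrow> int list \<Rightarrow> int list \<Rightarrow> increasing_word \<Rightarrow> increasing_word option" where
  "swap_prefix n u v w =
     (if takeWhile (\<lambda>k. k \<le> int n) (letters w) = u
      then Some (word (v @ dropWhile (\<lambda>k. k \<le> int n) (letters w))) else None)"

lemma swap_prefix_word:
  assumes "sorted_wrt (<) (u' @ y)" "\<forall>k\<in>set u'. k \<le> int n" "\<forall>k\<in>set y. int n < k"
  shows "swap_prefix n u v (word (u' @ y)) = (if u' = u then Some (word (v @ y)) else None)"
proof -
  have "takeWhile (\<lambda>k. k \<le> int n) y = []" "dropWhile (\<lambda>k. k \<le> int n) y = y"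
    using assms(3) by (cases y; force)+
  moreover have "takeWhile (\<lambda>k. k \<le> int n) (u' @ y) = u' @ takeWhile (\<lambda>k. k \<le> int n) y"
    "dropWhile (\<lambda>k. k \<le> int n) (u' @ y) = dropWhile (\<lambda>k. k \<le> int n) y"
    using assms(2) by (simp_all add: takeWhile_append2 dropWhile_append2)
  ultimately show ?thesis
    using assms(1) by (cases "u' = u") (auto simp: swap_prefix_def letters_word)
qed

text \<open>The letters of \<open>v\<close> are at most \<open>n\<close>, so after the trade
  \<open>v y\<close> is still increasing and its cut at \<open>n\<close> returns \<open>v\<close>;
  trading back recovers the original word.\<close>

lemma swap_prefix_inverse:
  assumes u: "u \<in> set (block_words n)" and v: "v \<in> set (block_words n)"
  shows "swap_prefix n u v w = Some w' \<longleftrightarrow> swap_prefix n v u w' = Some w"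
proof -
  \<comment> \<open>One implication for arbitrary block words; the other is the same with
    \<open>u\<close> and \<open>v\<close> interchanged.\<close>
  have "swap_prefix n v u w' = Some w"
    if u: "u \<in> set (block_words n)" and v: "v \<in> set (block_words n)"
      and h: "swap_prefix n u v w = Some w'" for u v w w'
  proof -
    obtain u' y where w: "w = word (u' @ y)" and s: "sorted_wrt (<) (u' @ y)"
      and u': "\<forall>k\<in>set u'. k \<le> int n" and y: "\<forall>k\<in>set y. int n < k"
      using word_decomposition .
    have uu: "u' = u" and w': "w' = word (v @ y)"
      using h swap_prefix_word[OF s u' y] w by (auto split: if_splits)
    have "sorted_wrt (<) (v @ y)"
      using sorted_block_append[OF v _ y] s by (simp add: sorted_wrt_append)
    from swap_prefix_word[OF this _ y, of v u] show ?thesis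
      using block_wordsD(2)[OF v] w w' uu by auto
  qed
  thus ?thesis using u v by blast
qed

definition matrix_unit :: "nat \<Rightarrow> int list \<Rightarrow> int list \<Rightarrow> increasing_word operator" where
  "matrix_unit n u v = relabel (swap_prefix n u v)"

context
  fixes n u v
  assumes u: "u \<in> set (block_words n)" and v: "v \<in> set (block_words n)"
begin

lemma inj_swap_prefix: "inj_on (swap_prefix n u v) (dom (swap_prefix n u v))"
  by (rule inj_on_dom_partial_inverse) (rule swap_prefix_inverse[OF u v])

lemma coord_matrix_unit:
  assumes "sorted_wrt (<) (u' @ y)" "\<forall>k\<in>set u'. k \<le> int n" "\<forall>k\<in>set y. int n < k"
  shows "coord (blinfun_apply (matrix_unit n u v) x) (word (u' @ y))
    = (if u' = u then coord x (word (v @ y)) else 0)"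
  unfolding matrix_unit_def coord_relabel[OF inj_swap_prefix] swap_prefix_word[OF assms] by simp

lemma complex_linear_matrix_unit: "complex_linear (matrix_unit n u v)"
  unfolding matrix_unit_def by (rule complex_linear_relabel[OF inj_swap_prefix])

lemma is_adjoint_matrix_unit: "is_adjoint (matrix_unit n v u) (matrix_unit n u v)"
  unfolding matrix_unit_def by (rule is_adjoint_relabel) (rule swap_prefix_inverse[OF u v])

end

text \<open>The adjoint of \<open>annihilator i\<close>. In pulled-back form, adding the letter
  \<open>i\<close> to a basis word appears as stripping a leading \<open>i\<close>.\<close>

definition creation :: "int \<Rightarrow> increasing_word operator" where
  "creation i = relabel (\<lambda>w. case letters w of [] \<Rightarrow> None
     | k # l \<Rightarrow> if k = i then Some (word l) else None)"

lemma prepend_inverse: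
  "(if sorted_wrt (<) (i # letters w) then Some (word (i # letters w)) else None) = Some v \<longleftrightarrow>
   (case letters v of [] \<Rightarrow> None | k # l \<Rightarrow> if k = i then Some (word l) else None) = Some w"
proof -
  have s: "sorted_wrt (<) (letters v)" using letters[of v] by simp
  show ?thesis
  proof
    assume "(if sorted_wrt (<) (i # letters w) then Some (word (i # letters w)) else None) = Some v"
    hence "letters v = i # letters w" by (auto simp: letters_word split: if_splits)
    thus "(case letters v of [] \<Rightarrow> None | k # l \<Rightarrow> if k = i then Some (word l) else None) = Some w"
      by (simp add: letters_inverse)
  next
    assume "(case letters v of [] \<Rightarrow> None | k # l \<Rightarrow> if k = i then Some (word l) else None) = Some w"
    then obtain l where l: "letters v = i # l" "w = word l"
      by (auto split: list.splits if_splits)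
    hence "letters w = l" using s by (simp add: letters_word)
    thus "(if sorted_wrt (<) (i # letters w) then Some (word (i # letters w)) else None) = Some v"
      using l s by (metis letters_inverse)
  qed
qed

text \<open>In this form the adjoint of the annihilator comes from
  \<open>is_adjoint_relabel\<close>.\<close>

lemma annihilator_relabel:
  "annihilator i =
     relabel (\<lambda>w. if sorted_wrt (<) (i # letters w) then Some (word (i # letters w)) else None)"
    (is "_ = relabel ?h")
proof -
  have "inj_on ?h (dom ?h)"
    by (rule inj_on_dom_partial_inverse) (rule prepend_inverse)
  thus ?thesis
    by (intro blinfun_eqI ell2_ext)
       (simp add: annihilator_apply annihilator_fun.rep_eq coord_relabel)
qed

lemma is_adjoint_creation: "is_adjoint (creation i) (annihilator i)"
  unfolding annihilator_relabel creation_def by (rule is_adjoint_relabel) (rule prepend_inverse)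

lemma coord_annihilator:
  assumes "sorted_wrt (<) l"
  shows "coord (blinfun_apply (annihilator i) x) (word l)
    = (if sorted_wrt (<) (i # l) then coord x (word (i # l)) else 0)"
  using assms by (simp add: annihilator_apply annihilator_fun.rep_eq letters_word)

lemma coord_creation:
  assumes "sorted_wrt (<) l"
  shows "coord (blinfun_apply (creation i) x) (word l)
    = (case l of [] \<Rightarrow> 0 | k # l' \<Rightarrow> if k = i then coord x (word l') else 0)"
  unfolding creation_def
  by (subst coord_relabel, rule inj_on_dom_partial_inverse, rule prepend_inverse[symmetric])
     (use assms in \<open>simp add: letters_word split: list.splits\<close>)

lemma operator_eqI:
  fixes S T :: "increasing_word operator"
  assumes "\<And>x u y. sorted_wrt (<) (u @ y) \<Longrightarrow> \<forall>k\<in>set u. k \<le> m \<Longrightarrow> \<forall>k\<in>set y. m < k \<Longrightarrow>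
    coord (blinfun_apply S x) (word (u @ y)) = coord (blinfun_apply T x) (word (u @ y))"
  shows "S = T"
proof (intro blinfun_eqI ell2_ext)
  fix x w
  show "coord (blinfun_apply S x) w = coord (blinfun_apply T x) w"
    by (rule word_decomposition[of w m]) (use assms in auto)
qed

text \<open>The composite preserves the coordinate at \<open>u y\<close> if \<open>n\<close> can be
  put in front and makes it 0 otherwise. As the letters of \<open>u\<close> are at most
  \<open>n\<close> and those of \<open>y\<close> above it, the condition says
  \<open>u = []\<close>.\<close>

lemma vacuum_block_projection:
  "annihilator (int n) o\<^sub>L creation (int n) = matrix_unit n [] []"
proof (rule operator_eqI[where m = "int n"])
  fix x u y
  assume s: "sorted_wrt (<) (u @ y)" and u: "\<forall>k\<in>set u. k \<le> int n" and y: "\<forall>k\<in>set y. int n < k"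
  have "sorted_wrt (<) (int n # u @ y) \<longleftrightarrow> u = []"
    using s u y by (cases u) auto
  thus "coord (blinfun_apply (annihilator (int n) o\<^sub>L creation (int n)) x) (word (u @ y))
      = coord (blinfun_apply (matrix_unit n [] []) x) (word (u @ y))"
    using s coord_matrix_unit[OF Nil_in_block_words Nil_in_block_words s u y]
    by (auto simp: coord_annihilator coord_creation)
qed

text \<open>Induction step by which all units with second index \<open>[]\<close> arise from
  \<open>matrix_unit n [] []\<close>, one leading letter at a time.\<close>

lemma creation_matrix_unit:
  assumes iu: "i # u \<in> set (block_words n)"
  shows "creation i o\<^sub>L matrix_unit n u [] = matrix_unit n (i # u) []"
proof (rule operator_eqI[where m = "int n"])
  fix x u' y
  assume s: "sorted_wrt (<) (u' @ y)" and u': "\<forall>k\<in>set u'. k \<le> int n" and y: "\<forall>k\<in>set y. int n < k"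
  have u: "u \<in> set (block_words n)" and i: "i \<le> int n" using iu by (auto simp: set_block_words)
  show "coord (blinfun_apply (creation i o\<^sub>L matrix_unit n u []) x) (word (u' @ y))
      = coord (blinfun_apply (matrix_unit n (i # u) []) x) (word (u' @ y))"
  proof (cases u')
    \<comment> \<open>The remaining word \<open>y\<close> is empty or starts above \<open>n\<close>,
      hence not with \<open>i\<close>, so the creator gives 0 as well.\<close>
    case Nil
    have "coord (blinfun_apply (matrix_unit n (i # u) []) x) (word (u' @ y)) = 0"
      using coord_matrix_unit[OF iu Nil_in_block_words s u' y] Nil by simp
    thus ?thesis using s y i Nil by (cases y) (auto simp: coord_creation)
  next
    case (Cons k l)
    hence "sorted_wrt (<) (l @ y)" "\<forall>k\<in>set l. k \<le> int n" using s u' by auto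
    from coord_matrix_unit[OF u Nil_in_block_words this y]
    show ?thesis using s coord_matrix_unit[OF iu Nil_in_block_words s u' y]
      by (cases "l = u") (auto simp: coord_creation Cons)
  qed
qed

declare block_words.simps(2) [simp del]

section \<open>The matrix blocks\<close>

lemma coord_sum: "coord (\<Sum>k\<in>K. f k) a = (\<Sum>k\<in>K. coord (f k) a)"
  by (induction K rule: infinite_finite_induct) auto

lemma index_mat_adjoint:
  "i < dim_col A \<Longrightarrow> j < dim_row A \<Longrightarrow> mat_adjoint A $$ (i, j) = conjugate (A $$ (j, i))"
  "dim_row (mat_adjoint A) = dim_col A" "dim_col (mat_adjoint A) = dim_row A"
  by (auto simp: mat_adjoint_def mat_of_rows_def)

lemma mat_adjoint_carrier: "A \<in> carrier_mat m n \<Longrightarrow> mat_adjoint A \<in> carrier_mat n m"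
  by (intro carrier_matI) (auto simp: index_mat_adjoint(2,3))

abbreviation block_dim :: "nat \<Rightarrow> nat" where
  "block_dim n \<equiv> length (block_words n)"

definition matrix_operator :: "nat \<Rightarrow> complex mat \<Rightarrow> increasing_word operator" where
  "matrix_operator n A = (\<Sum>i<block_dim n. \<Sum>j<block_dim n.
     scaleC_op (A $$ (i, j)) (matrix_unit n (block_words n ! i) (block_words n ! j)))"

text \<open>Only basis words with empty tail \<open>y\<close> are tested. This determines an element
  of the block algebra, which acts by the same matrix for every tail.\<close>

definition operator_matrix :: "nat \<Rightarrow> increasing_word operator \<Rightarrow> complex mat" where
  "operator_matrix n T = Matrix.mat (block_dim n) (block_dim n) (\<lambda>(i, j).
     coord (blinfun_apply T (ket (word (block_words n ! j)))) (word (block_words n ! i)))"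

definition block_algebra :: "nat \<Rightarrow> increasing_word operator set" where
  "block_algebra n = matrix_operator n ` carrier_mat (block_dim n) (block_dim n)"

lemma coord_matrix_operator_sum:
  assumes "sorted_wrt (<) (u @ y)" "\<forall>k\<in>set u. k \<le> int n" "\<forall>k\<in>set y. int n < k"
  shows "coord (blinfun_apply (matrix_operator n A) x) (word (u @ y)) =
    (\<Sum>i<block_dim n. \<Sum>j<block_dim n. A $$ (i, j) *
       (if u = block_words n ! i then coord x (word (block_words n ! j @ y)) else 0))"
  unfolding matrix_operator_def
  by (simp add: blinfun.sum_left coord_sum scaleC_op_apply coord_matrix_unit[OF _ _ assms]
        cong: if_cong)

text \<open>The matrix acts on the prefix and leaves the tail \<open>y\<close> alone, like
  \<open>A\<close> tensored with an identity. Distinctness of the block words selects row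
  \<open>i\<close>.\<close>

lemma coord_matrix_operator:
  assumes "i < block_dim n" "sorted_wrt (<) y" "\<forall>k\<in>set y. int n < k"
  shows "coord (blinfun_apply (matrix_operator n A) x) (word (block_words n ! i @ y)) =
    (\<Sum>j<block_dim n. A $$ (i, j) * coord x (word (block_words n ! j @ y)))"
proof -
  have i: "block_words n ! i \<in> set (block_words n)" using assms(1) by simp
  have "coord (blinfun_apply (matrix_operator n A) x) (word (block_words n ! i @ y)) =
    (\<Sum>i'<block_dim n. \<Sum>j<block_dim n. A $$ (i', j) *
       (if block_words n ! i = block_words n ! i' then coord x (word (block_words n ! j @ y)) else 0))"
    by (rule coord_matrix_operator_sum[OF sorted_block_append[OF i assms(2,3)] _ assms(3)])
       (use block_wordsD(2)[OF i] in blast)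
  also have "\<dots> = (\<Sum>i'<block_dim n. if i = i' then
      (\<Sum>j<block_dim n. A $$ (i', j) * coord x (word (block_words n ! j @ y))) else 0)"
    by (rule sum.cong) (use assms(1) in \<open>auto simp: nth_eq_iff_index_eq[OF distinct_block_words]\<close>)
  finally show ?thesis using assms(1) by simp
qed

lemma coord_matrix_operator_outside:
  assumes "sorted_wrt (<) (u @ y)" "\<forall>k\<in>set u. k \<le> int n" "\<forall>k\<in>set y. int n < k"
    "u \<notin> set (block_words n)"
  shows "coord (blinfun_apply (matrix_operator n A) x) (word (u @ y)) = 0"
proof -
  have "u \<noteq> block_words n ! i" if "i < block_dim n" for i
    using assms(4) that by auto
  thus ?thesis
    unfolding coord_matrix_operator_sum[OF assms(1-3)] by simp
qed

text \<open>Coordinates are of two kinds: prefixes in the block, and prefixes with a letter below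
  \<open>- int n\<close>, at which the images under block operators vanish.\<close>

lemma block_operator_eqI:
  fixes S T :: "increasing_word operator"
  assumes "\<And>x i y. i < block_dim n \<Longrightarrow> sorted_wrt (<) y \<Longrightarrow> \<forall>k\<in>set y. int n < k \<Longrightarrow>
      coord (blinfun_apply S x) (word (block_words n ! i @ y))
        = coord (blinfun_apply T x) (word (block_words n ! i @ y))"
    and "\<And>x u y. sorted_wrt (<) (u @ y) \<Longrightarrow> \<forall>k\<in>set u. k \<le> int n \<Longrightarrow> \<forall>k\<in>set y. int n < k \<Longrightarrow>
      u \<notin> set (block_words n) \<Longrightarrow>
      coord (blinfun_apply S x) (word (u @ y)) = coord (blinfun_apply T x) (word (u @ y))"
  shows "S = T"
proof (rule operator_eqI[where m = "int n"])
  fix x u y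
  assume *: "sorted_wrt (<) (u @ y)" "\<forall>k\<in>set u. k \<le> int n" "\<forall>k\<in>set y. int n < k"
  show "coord (blinfun_apply S x) (word (u @ y)) = coord (blinfun_apply T x) (word (u @ y))"
  proof (cases "u \<in> set (block_words n)")
    case True
    then obtain i where "i < block_dim n" "u = block_words n ! i" by (auto simp: in_set_conv_nth)
    thus ?thesis using assms(1)[of i y x] * by (auto simp: sorted_wrt_append)
  qed (use assms(2) * in blast)
qed

lemma matrix_operator_add:
  assumes "A \<in> carrier_mat (block_dim n) (block_dim n)" "B \<in> carrier_mat (block_dim n) (block_dim n)"
  shows "matrix_operator n (A + B) = matrix_operator n A + matrix_operator n B"
  using carrier_matD[OF assms(1)] carrier_matD[OF assms(2)]
  by (intro block_operator_eqI[where n = n])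
     (simp_all add: coord_matrix_operator coord_matrix_operator_outside blinfun.add_left
        sum.distrib distrib_right cong: sum.cong_simp)

lemma matrix_operator_smult:
  assumes "A \<in> carrier_mat (block_dim n) (block_dim n)"
  shows "matrix_operator n (c \<cdot>\<^sub>m A) = scaleC_op c (matrix_operator n A)"
  using carrier_matD[OF assms]
  by (intro block_operator_eqI[where n = n])
     (simp_all add: coord_matrix_operator coord_matrix_operator_outside scaleC_op_apply
        sum_distrib_left mult.assoc cong: sum.cong_simp)

lemma matrix_operator_zero:
  "matrix_operator n (0\<^sub>m (block_dim n) (block_dim n)) = 0"
  by (intro block_operator_eqI[where n = n])
     (auto simp: coord_matrix_operator coord_matrix_operator_outside)

lemma matrix_operator_mult:
  assumes A: "A \<in> carrier_mat (block_dim n) (block_dim n)"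
    and B: "B \<in> carrier_mat (block_dim n) (block_dim n)"
  shows "matrix_operator n (A * B) = matrix_operator n A o\<^sub>L matrix_operator n B"
proof (rule block_operator_eqI[where n = n])
  fix x i y
  assume i: "i < block_dim n" and y: "sorted_wrt (<) y" "\<forall>k\<in>set y. int n < k"
  let ?d = "block_dim n" and ?c = "\<lambda>j. coord x (word (block_words n ! j @ y))"
  have "coord (blinfun_apply (matrix_operator n (A * B)) x) (word (block_words n ! i @ y))
    = (\<Sum>j<?d. (\<Sum>k<?d. A $$ (i, k) * B $$ (k, j)) * ?c j)"
    using A B i y
    by (auto simp: coord_matrix_operator scalar_prod_def lessThan_atLeast0 intro!: sum.cong)
  also have "\<dots> = (\<Sum>k<?d. A $$ (i, k) * (\<Sum>j<?d. B $$ (k, j) * ?c j))"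
    by (simp add: sum_distrib_left sum_distrib_right mult.assoc) (rule sum.swap)
  also have "\<dots> = coord (blinfun_apply (matrix_operator n A o\<^sub>L matrix_operator n B) x)
      (word (block_words n ! i @ y))"
    using i y by (simp add: coord_matrix_operator)
  finally show "coord (blinfun_apply (matrix_operator n (A * B)) x) (word (block_words n ! i @ y))
    = coord (blinfun_apply (matrix_operator n A o\<^sub>L matrix_operator n B) x)
      (word (block_words n ! i @ y))" .
qed (simp add: coord_matrix_operator_outside)

lemma is_adjoint_matrix_operator:
  assumes "A \<in> carrier_mat (block_dim n) (block_dim n)"
  shows "is_adjoint (matrix_operator n (mat_adjoint A)) (matrix_operator n A)"
proof -
  let ?d = "block_dim n" and ?E = "\<lambda>i j. matrix_unit n (block_words n ! i) (block_words n ! j)"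
  \<comment> \<open>The adjoint matrix has the conjugate of \<open>A $$ (i, j)\<close> at
    \<open>(j, i)\<close>; interchanging the sums attaches it to \<open>?E j i\<close>, the adjoint
    of \<open>?E i j\<close>.\<close>
  have "matrix_operator n (mat_adjoint A) = (\<Sum>i<?d. \<Sum>j<?d. scaleC_op (cnj (A $$ (i, j))) (?E j i))"
    unfolding matrix_operator_def
    by (subst sum.swap) (use assms in \<open>auto simp: index_mat_adjoint conjugate_complex_def intro!: sum.cong\<close>)
  thus ?thesis
    unfolding matrix_operator_def
    by (simp, intro is_adjoint_sum is_adjoint_scaleC is_adjoint_matrix_unit) auto
qed

lemma complex_linear_matrix_operator: "complex_linear (matrix_operator n A)"
proof -
  have "blinfun_apply (matrix_operator n A) (c *\<^sub>C x) = c *\<^sub>C blinfun_apply (matrix_operator n A) x" for c x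
  proof (rule ell2_ext)
    fix w
    have "coord (blinfun_apply (matrix_unit n (block_words n ! i) (block_words n ! j)) (c *\<^sub>C x)) w
        = c * coord (blinfun_apply (matrix_unit n (block_words n ! i) (block_words n ! j)) x) w"
      if "i < block_dim n" "j < block_dim n" for i j
      using complex_linear_matrix_unit[of "block_words n ! i" n "block_words n ! j"] that
      by (simp add: complex_linear_def)
    thus "coord (blinfun_apply (matrix_operator n A) (c *\<^sub>C x)) w
        = coord (c *\<^sub>C blinfun_apply (matrix_operator n A) x) w"
      by (simp add: matrix_operator_def blinfun.sum_left coord_sum scaleC_op_apply
            sum_distrib_left mult.left_commute)
  qed
  thus ?thesis by (simp add: complex_linear_def)
qed

lemma operator_matrix_carrier: "operator_matrix n T \<in> carrier_mat (block_dim n) (block_dim n)"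
  by (simp add: operator_matrix_def)

lemma coord_ket_word:
  assumes "sorted_wrt (<) u" "sorted_wrt (<) v"
  shows "coord (ket (word u)) (word v) = (if v = u then 1 else 0)"
  using assms by (simp add: ket.rep_eq word_eq_iff)

lemma operator_matrix_matrix_operator:
  assumes "A \<in> carrier_mat (block_dim n) (block_dim n)"
  shows "operator_matrix n (matrix_operator n A) = A"
proof (rule eq_matI)
  fix i j assume "i < dim_row A" "j < dim_col A"
  hence ij: "i < block_dim n" "j < block_dim n" using assms by auto
  have "operator_matrix n (matrix_operator n A) $$ (i, j)
      = (\<Sum>k<block_dim n. A $$ (i, k) * coord (ket (word (block_words n ! j))) (word (block_words n ! k)))"
    using coord_matrix_operator[OF ij(1), of "[]"] ij by (simp add: operator_matrix_def)
  also have "\<dots> = (\<Sum>k<block_dim n. if k = j then A $$ (i, k) else 0)"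
    using ij by (intro sum.cong)
      (auto simp: coord_ket_word block_wordsD(1)[of _ n] nth_eq_iff_index_eq[OF distinct_block_words])
  finally show "operator_matrix n (matrix_operator n A) $$ (i, j) = A $$ (i, j)"
    using ij by simp
qed (use assms in \<open>auto simp: operator_matrix_def\<close>)

text \<open>\<open>operator_matrix\<close> is a left inverse of \<open>matrix_operator\<close> on
  matrices of this size, so the image consists of the operators fixed by the round trip. This form
  serves both closedness and bijectivity.\<close>

lemma block_algebra_fixed: "block_algebra n = {T. matrix_operator n (operator_matrix n T) = T}"
  unfolding block_algebra_def
  by (auto simp: operator_matrix_matrix_operator) (metis image_eqI operator_matrix_carrier)

lemma bounded_linear_coord: "bounded_linear (\<lambda>x. coord x a)"
  by (rule bounded_linear_intro[where K = 1]) (auto simp: norm_coord_le scaleR_conv_of_real)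

lemma bounded_linear_scaleC_op_left: "bounded_linear (\<lambda>c. scaleC_op c T)"
proof (rule bounded_linear_intro[where K = "norm T"])
  fix c d :: complex and r :: real
  show "scaleC_op (c + d) T = scaleC_op c T + scaleC_op d T"
    by (rule blinfun_eqI, rule ell2_ext) (simp add: scaleC_op_apply blinfun.add_left distrib_right)
  show "scaleC_op (r *\<^sub>R c) T = r *\<^sub>R scaleC_op c T"
    by (rule blinfun_eqI, rule ell2_ext)
       (simp add: scaleC_op_apply blinfun.scaleR_left scaleR_conv_of_real)
  show "norm (scaleC_op c T) \<le> norm c * norm T"
    by (rule norm_blinfun_bound)
       (simp_all add: scaleC_op_apply norm_scaleC mult.assoc mult_left_mono norm_blinfun)
qed

text \<open>The block is the equalizer of two continuous maps.\<close>

lemma closed_block_algebra: "closed (block_algebra n)"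
  unfolding block_algebra_fixed
proof (rule closed_Collect_eq)
  let ?w = "\<lambda>i. word (block_words n ! i)"
  \<comment> \<open>Written out, the round trip is a finite sum of fixed operators scaled by
    coordinates that depend continuously on \<open>T\<close>.\<close>
  have "matrix_operator n (operator_matrix n T) = (\<Sum>i<block_dim n. \<Sum>j<block_dim n.
      scaleC_op (coord (blinfun_apply T (ket (?w j))) (?w i))
        (matrix_unit n (block_words n ! i) (block_words n ! j)))" for T
    by (simp add: matrix_operator_def operator_matrix_def)
  thus "continuous_on UNIV (\<lambda>T. matrix_operator n (operator_matrix n T))"
    by (simp, intro continuous_on_sum bounded_linear.continuous_on[OF bounded_linear_scaleC_op_left]
        bounded_linear.continuous_on[OF bounded_linear_coord]
        bounded_linear.continuous_on[OF blinfun.bounded_linear_left] continuous_on_id)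
qed (rule continuous_on_id)

lemma cstar_subalgebra_block_algebra: "cstar_subalgebra (block_algebra n)"
  unfolding cstar_subalgebra_def
proof (intro conjI ballI allI)
  show "0 \<in> block_algebra n"
    unfolding block_algebra_def by (rule image_eqI[where x = "0\<^sub>m (block_dim n) (block_dim n)"]) (simp_all add: matrix_operator_zero)
  show "closed (block_algebra n)" by (rule closed_block_algebra)
  fix T assume "T \<in> block_algebra n"
  then obtain B where B: "B \<in> carrier_mat (block_dim n) (block_dim n)" "T = matrix_operator n B"
    unfolding block_algebra_def by blast
  show "complex_linear T" using B complex_linear_matrix_operator by simp
  show "scaleC_op c T \<in> block_algebra n" for c
    unfolding block_algebra_def B(2) matrix_operator_smult[OF B(1), symmetric] using B(1) by simp
  have "mat_adjoint B \<in> carrier_mat (block_dim n) (block_dim n)"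
    by (rule mat_adjoint_carrier[OF B(1)])
  thus "\<exists>S\<in>block_algebra n. is_adjoint S T"
    unfolding block_algebra_def B(2) using is_adjoint_matrix_operator[OF B(1)] by auto
next
  fix S T assume "S \<in> block_algebra n" "T \<in> block_algebra n"
  then obtain A B where A: "A \<in> carrier_mat (block_dim n) (block_dim n)" "S = matrix_operator n A"
    and B: "B \<in> carrier_mat (block_dim n) (block_dim n)" "T = matrix_operator n B"
    unfolding block_algebra_def by blast
  show "S + T \<in> block_algebra n"
    unfolding block_algebra_def A(2) B(2) matrix_operator_add[OF A(1) B(1), symmetric]
    using A(1) B(1) by simp
  show "S o\<^sub>L T \<in> block_algebra n"
    unfolding block_algebra_def A(2) B(2) matrix_operator_mult[OF A(1) B(1), symmetric]
    using A(1) B(1) by simp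
qed

section \<open>Generation of the block algebra by the annihilators\<close>

lemma annihilator_in_block_algebra:
  assumes i: "\<bar>i\<bar> \<le> int n"
  shows "annihilator i \<in> block_algebra n"
proof -
  let ?d = "block_dim n" and ?L = "block_words n"
  \<comment> \<open>Removing a leading \<open>i\<close> is the sum of the units \<open>E_uv\<close>
    with \<open>v = i # u\<close>, where both words lie in the block.\<close>
  define A :: "complex mat" where
    "A = Matrix.mat ?d ?d (\<lambda>(a, b). if ?L ! b = i # ?L ! a then 1 else 0)"
  have "annihilator i = matrix_operator n A"
  proof (rule block_operator_eqI[where n = n])
    fix x a y
    assume a: "a < ?d" and y: "sorted_wrt (<) y" "\<forall>k\<in>set y. int n < k"
    have aL: "?L ! a \<in> set ?L" using a by simp
    have s: "sorted_wrt (<) (?L ! a @ y)" by (rule sorted_block_append[OF aL y])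
    \<comment> \<open>As \<open>i\<close> is at most \<open>n\<close> and \<open>y\<close> lies
      above \<open>n\<close>, the prefix alone decides whether \<open>i\<close> may be put in
      front.\<close>
    have eq: "sorted_wrt (<) (i # ?L ! a @ y) \<longleftrightarrow> i # ?L ! a \<in> set ?L"
      using s i y block_wordsD[OF aL] by (fastforce simp: set_block_words)
    have "coord (blinfun_apply (matrix_operator n A) x) (word (?L ! a @ y))
        = (\<Sum>b<?d. if ?L ! b = i # ?L ! a then coord x (word (?L ! b @ y)) else 0)"
      unfolding coord_matrix_operator[OF a y] by (rule sum.cong) (use a in \<open>auto simp: A_def\<close>)
    also have "\<dots> = (if i # ?L ! a \<in> set ?L then coord x (word (i # ?L ! a @ y)) else 0)"
    proof (cases "i # ?L ! a \<in> set ?L")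
      case True
      then obtain b where b: "b < ?d" "?L ! b = i # ?L ! a" by (metis in_set_conv_nth)
      have "(\<Sum>b<?d. if ?L ! b = i # ?L ! a then coord x (word (?L ! b @ y)) else 0)
          = (\<Sum>b'<?d. if b' = b then coord x (word (?L ! b' @ y)) else 0)"
        by (rule sum.cong)
           (use b in \<open>auto simp: nth_eq_iff_index_eq[OF distinct_block_words] simp flip: b(2)\<close>)
      thus ?thesis using b True by simp
    next
      case False
      hence "?L ! b \<noteq> i # ?L ! a" if "b < ?d" for b using that nth_mem by metis
      thus ?thesis using False by simp
    qed
    finally show "coord (blinfun_apply (annihilator i) x) (word (?L ! a @ y))
        = coord (blinfun_apply (matrix_operator n A) x) (word (?L ! a @ y))"
      unfolding coord_annihilator[OF s] eq by simp
  next
    fix x u y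
    assume *: "sorted_wrt (<) (u @ y)" "\<forall>k\<in>set u. k \<le> int n" "\<forall>k\<in>set y. int n < k"
      "u \<notin> set ?L"
    \<comment> \<open>An increasing prefix outside the block has a letter below
      \<open>- int n\<close>, hence below \<open>i\<close>, so \<open>i\<close> cannot precede
      it.\<close>
    have "\<not> sorted_wrt (<) (i # u @ y)"
    proof
      assume "sorted_wrt (<) (i # u @ y)"
      hence "sorted_wrt (<) u" "\<forall>k\<in>set u. i < k" by (auto simp: sorted_wrt_append)
      hence "u \<in> set ?L" using *(2) i by (fastforce simp: set_block_words)
      thus False using *(4) by blast
    qed
    thus "coord (blinfun_apply (annihilator i) x) (word (u @ y))
        = coord (blinfun_apply (matrix_operator n A) x) (word (u @ y))"
      by (simp only: coord_annihilator[OF *(1)] coord_matrix_operator_outside[OF *] if_False)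
  qed
  thus ?thesis unfolding block_algebra_def by (simp add: A_def)
qed

lemma cstar_subalgebra_adjoint:
  "cstar_subalgebra A \<Longrightarrow> T \<in> A \<Longrightarrow> is_adjoint S T \<Longrightarrow> S \<in> A"
  unfolding cstar_subalgebra_def using is_adjoint_unique by metis

lemma cstar_subalgebra_sum:
  "cstar_subalgebra A \<Longrightarrow> (\<And>k. k \<in> K \<Longrightarrow> T k \<in> A) \<Longrightarrow> (\<Sum>k\<in>K. T k) \<in> A"
  by (induction K rule: infinite_finite_induct) (auto simp: cstar_subalgebra_def)

text \<open>Minimality of the block: creators build the units \<open>E_u[]\<close> from the
  projection \<open>E_[][]\<close>, adjoints give \<open>E_[]v\<close>, and the products
  \<open>E_u[] E_[]v = E_uv\<close> span everything.\<close>

lemma block_algebra_subset: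
  assumes A: "cstar_subalgebra A" and gen: "annihilator ` {i. \<bar>i\<bar> \<le> int n} \<subseteq> A"
  shows "block_algebra n \<subseteq> A"
proof -
  have comp: "S o\<^sub>L T \<in> A" if "S \<in> A" "T \<in> A" for S T
    using A that by (auto simp: cstar_subalgebra_def)
  have cre: "creation i \<in> A" if "\<bar>i\<bar> \<le> int n" for i
    using cstar_subalgebra_adjoint[OF A _ is_adjoint_creation] gen that by blast
  have col: "u \<in> set (block_words n) \<Longrightarrow> matrix_unit n u [] \<in> A" for u
  proof (induction u)
    case Nil
    have "annihilator (int n) \<in> A" using gen by auto
    thus ?case
      unfolding vacuum_block_projection[symmetric] by (intro comp cre) auto
  next
    case (Cons i u)
    hence "u \<in> set (block_words n)" "\<bar>i\<bar> \<le> int n" by (auto simp: set_block_words)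
    thus ?case
      unfolding creation_matrix_unit[OF Cons.prems, symmetric] by (intro comp cre Cons.IH)
  qed
  have unit: "matrix_unit n u v \<in> A" if u: "u \<in> set (block_words n)" and v: "v \<in> set (block_words n)" for u v
  proof -
    have "matrix_unit n u v = matrix_unit n u [] o\<^sub>L matrix_unit n [] v"
    proof (rule operator_eqI[where m = "int n"])
      fix x w y
      assume *: "sorted_wrt (<) (w @ y)" "\<forall>k\<in>set w. k \<le> int n" "\<forall>k\<in>set y. int n < k"
      hence "sorted_wrt (<) ([] @ y)" by (simp add: sorted_wrt_append)
      thus "coord (blinfun_apply (matrix_unit n u v) x) (word (w @ y))
          = coord (blinfun_apply (matrix_unit n u [] o\<^sub>L matrix_unit n [] v) x) (word (w @ y))"
        using coord_matrix_unit[OF Nil_in_block_words v, of "[]" y] *(3)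
        by (simp add: coord_matrix_unit[OF u v *] coord_matrix_unit[OF u Nil_in_block_words *])
    qed
    thus ?thesis
      using comp[OF col[OF u] cstar_subalgebra_adjoint[OF A col[OF v]
        is_adjoint_matrix_unit[OF v Nil_in_block_words]]] by simp
  qed
  have scale: "scaleC_op c T \<in> A" if "T \<in> A" for c T
    using A that by (auto simp: cstar_subalgebra_def)
  thus ?thesis
    unfolding block_algebra_def matrix_operator_def
    by (auto intro!: cstar_subalgebra_sum[OF A] scale unit)
qed

section \<open>The algebras \<open>\<BB> n\<close> and \<open>\<II>\<close> in terms of
  blocks\<close>

lemma cstar_generated_eqI:
  assumes "cstar_subalgebra M" "X \<subseteq> M" "\<And>A. cstar_subalgebra A \<Longrightarrow> X \<subseteq> A \<Longrightarrow> M \<subseteq> A"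
  shows "cstar_generated X = M"
  using assms unfolding cstar_generated_def by blast

lemma monotone_B_eq: "\<BB> n = block_algebra n"
  unfolding monotone_B_def
  by (rule cstar_generated_eqI)
     (auto intro: cstar_subalgebra_block_algebra annihilator_in_block_algebra
        dest: block_algebra_subset)

lemma monotone_B_mono: "m \<le> n \<Longrightarrow> \<BB> m \<subseteq> \<BB> n"
  unfolding monotone_B_eq
  by (intro block_algebra_subset cstar_subalgebra_block_algebra)
     (auto intro: annihilator_in_block_algebra)

lemma cstar_subalgebra_monotone_B: "cstar_subalgebra (\<BB> n)"
  unfolding monotone_B_eq by (rule cstar_subalgebra_block_algebra)

lemma cstar_subalgebra_closure_Union: "cstar_subalgebra (closure (\<Union>n. \<BB> n))"
proof (rule cstar_subalgebra_closure)
  note alg = cstar_subalgebra_monotone_B[unfolded cstar_subalgebra_def]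
  have "complex_linear T \<and> scaleC_op c T \<in> \<BB> n \<and> (\<exists>S\<in>\<BB> n. is_adjoint S T)"
    if "T \<in> \<BB> n" for n c T
    using alg[of n] that by simp
  thus "\<forall>T\<in>(\<Union>n. \<BB> n). complex_linear T"
    "\<forall>c. \<forall>T\<in>(\<Union>n. \<BB> n). scaleC_op c T \<in> (\<Union>n. \<BB> n)"
    "\<forall>T\<in>(\<Union>n. \<BB> n). \<exists>S\<in>(\<Union>n. \<BB> n). is_adjoint S T"
    by fast+
  show "0 \<in> (\<Union>n. \<BB> n)" using alg[of 0] by blast
  have "S + T \<in> (\<Union>n. \<BB> n) \<and> (S o\<^sub>L T) \<in> (\<Union>n. \<BB> n)"
    if "S \<in> (\<Union>n. \<BB> n)" "T \<in> (\<Union>n. \<BB> n)" for S T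
  proof -
    obtain m k where "S \<in> \<BB> m" "T \<in> \<BB> k" using \<open>S \<in> _\<close> \<open>T \<in> _\<close> by blast
    \<comment> \<open>The levels increase, so two elements can be added and multiplied within a
      common one.\<close>
    hence "S \<in> \<BB> (max m k)" "T \<in> \<BB> (max m k)"
      using monotone_B_mono[of m "max m k"] monotone_B_mono[of k "max m k"] by auto
    thus ?thesis using alg[of "max m k"] by (intro conjI UN_I[of "max m k"]) simp_all
  qed
  thus "\<forall>S\<in>(\<Union>n. \<BB> n). \<forall>T\<in>(\<Union>n. \<BB> n). S + T \<in> (\<Union>n. \<BB> n)"
    "\<forall>S\<in>(\<Union>n. \<BB> n). \<forall>T\<in>(\<Union>n. \<BB> n). S o\<^sub>L T \<in> (\<Union>n. \<BB> n)"
    by blast+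
qed

text \<open>Each \<open>annihilator i\<close> lies in level \<open>nat \<bar>i\<bar>\<close>, so the
  closure contains all generators; conversely, a closed algebra containing the generators contains
  every level.\<close>

lemma monotone_I_eq: "\<II> = closure (\<Union>n. \<BB> n)"
  unfolding monotone_I_def
proof (rule cstar_generated_eqI)
  show "cstar_subalgebra (closure (\<Union>n. \<BB> n))" by (rule cstar_subalgebra_closure_Union)
  have "annihilator i \<in> \<BB> (nat \<bar>i\<bar>)" for i
    unfolding monotone_B_eq by (rule annihilator_in_block_algebra) simp
  thus "range annihilator \<subseteq> closure (\<Union>n. \<BB> n)"
    using closure_subset[of "\<Union>n. \<BB> n"] by blast
  fix A :: "increasing_word operator set"
  assume A: "cstar_subalgebra A" "range annihilator \<subseteq> A"
  have "\<BB> n \<subseteq> A" for n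
    unfolding monotone_B_eq using A by (intro block_algebra_subset) auto
  moreover have "closed A" using A(1) by (simp add: cstar_subalgebra_def)
  ultimately show "closure (\<Union>n. \<BB> n) \<subseteq> A" by (intro closure_minimal) auto
qed

section \<open>The isomorphisms onto full matrix algebras\<close>

lemma bij_betw_operator_matrix:
  "bij_betw (operator_matrix n) (\<BB> n) (carrier_mat (block_dim n) (block_dim n))"
  by (rule bij_betw_byWitness[where f' = "matrix_operator n"])
     (auto simp: monotone_B_eq block_algebra_fixed operator_matrix_matrix_operator operator_matrix_carrier)

text \<open>The required identities are those of \<open>matrix_operator\<close>, read backwards
  through its inverse.\<close>

lemma matrix_isomorphism_operator_matrix:
  "matrix_isomorphism (\<BB> n) (block_dim n) (operator_matrix n)"
  unfolding matrix_isomorphism_def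
proof (intro conjI ballI allI impI)
  show "bij_betw (operator_matrix n) (\<BB> n) (carrier_mat (block_dim n) (block_dim n))"
    by (rule bij_betw_operator_matrix)
  fix T assume "T \<in> \<BB> n"
  then obtain B where B: "B \<in> carrier_mat (block_dim n) (block_dim n)" "T = matrix_operator n B"
    unfolding monotone_B_eq block_algebra_def by blast
  show "operator_matrix n (scaleC_op c T) = c \<cdot>\<^sub>m operator_matrix n T" for c
    using B by (simp add: matrix_operator_smult[symmetric] operator_matrix_matrix_operator)
next
  fix S T assume "S \<in> \<BB> n" "T \<in> \<BB> n"
  then obtain A B where A: "A \<in> carrier_mat (block_dim n) (block_dim n)" "S = matrix_operator n A"
    and B: "B \<in> carrier_mat (block_dim n) (block_dim n)" "T = matrix_operator n B"
    unfolding monotone_B_eq block_algebra_def by blast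
  show "operator_matrix n (S + T) = operator_matrix n S + operator_matrix n T"
    using A B by (simp add: matrix_operator_add[symmetric] operator_matrix_matrix_operator)
  show "operator_matrix n (S o\<^sub>L T) = operator_matrix n S * operator_matrix n T"
    using A B by (simp add: matrix_operator_mult[symmetric] operator_matrix_matrix_operator)
  \<comment> \<open>Adjoints are unique, so \<open>S\<close> must be the operator of the adjoint
    matrix.\<close>
  assume "is_adjoint S T"
  hence "S = matrix_operator n (mat_adjoint B)"
    using is_adjoint_matrix_operator[OF B(1)] unfolding B(2) by (rule is_adjoint_unique)
  moreover have "mat_adjoint B \<in> carrier_mat (block_dim n) (block_dim n)"
    by (rule mat_adjoint_carrier[OF B(1)])
  ultimately show "operator_matrix n S = mat_adjoint (operator_matrix n T)"
    using B by (simp add: operator_matrix_matrix_operator)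
qed

section \<open>The inclusions\<close>

lemma block_dim_Suc: "block_dim (Suc n) = 4 * block_dim n"
  by (simp add: block_words.simps(2))

text \<open>The first two quarters of the list carry the two copies of level \<open>n\<close>; every
  word in the last two begins with \<open>- int n - 1\<close>, which is outside the alphabet of
  level \<open>n\<close>.\<close>

lemma nth_block_words_Suc:
  "i < block_dim n \<Longrightarrow> block_words (Suc n) ! i = block_words n ! i"
  "i < block_dim n \<Longrightarrow> block_words (Suc n) ! (block_dim n + i) = block_words n ! i @ [int n + 1]"
  "2 * block_dim n \<le> i \<Longrightarrow> i < 4 * block_dim n \<Longrightarrow>
     \<exists>v. v \<in> set (block_words n) \<and> (block_words (Suc n) ! i = (- int n - 1) # v
       \<or> block_words (Suc n) ! i = (- int n - 1) # v @ [int n + 1])"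
proof -
  show "i < block_dim n \<Longrightarrow> block_words (Suc n) ! i = block_words n ! i"
    "i < block_dim n \<Longrightarrow> block_words (Suc n) ! (block_dim n + i) = block_words n ! i @ [int n + 1]"
    by (simp_all add: block_words.simps(2) nth_append)
  assume i: "2 * block_dim n \<le> i" "i < 4 * block_dim n"
  let ?d = "block_dim n"
  show "\<exists>v. v \<in> set (block_words n) \<and> (block_words (Suc n) ! i = (- int n - 1) # v
       \<or> block_words (Suc n) ! i = (- int n - 1) # v @ [int n + 1])"
  proof (cases "i < 3 * ?d")
    case True
    hence "block_words (Suc n) ! i = (- int n - 1) # block_words n ! (i - ?d - ?d)"
      "i - ?d - ?d < ?d" using i by (auto simp: block_words.simps(2) nth_append)
    thus ?thesis using nth_mem by blast
  next
    case False
    hence "block_words (Suc n) ! i = (- int n - 1) # block_words n ! (i - ?d - ?d - ?d) @ [int n + 1]"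
      "i - ?d - ?d - ?d < ?d" using i by (auto simp: block_words.simps(2) nth_append)
    thus ?thesis using nth_mem by blast
  qed
qed

lemma index_diag_block_mat_two_zero:
  fixes x :: "complex mat"
  assumes x: "x \<in> carrier_mat p p" and "i < 4 * p" "j < 4 * p"
  shows "diag_block_mat (replicate 2 x @ [0\<^sub>m (2 * p) (2 * p)]) $$ (i, j) =
    (if i < p then if j < p then x $$ (i, j) else 0
     else if i < 2 * p \<and> p \<le> j \<and> j < 2 * p then x $$ (i - p, j - p) else 0)"
proof -
  have "replicate 2 x = [x, x]" by (simp add: numeral_2_eq_2)
  moreover have "i < p + (p + 2 * p)" "j < p + (p + 2 * p)" using assms by simp_all
  moreover have "dim_row x = p" "dim_col x = p" using x by auto
  ultimately show ?thesis by (simp add: Let_def) arith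
qed

lemma diag_block_mat_two_zero_carrier:
  assumes "x \<in> carrier_mat p p"
  shows "diag_block_mat (replicate 2 x @ [0\<^sub>m (2 * p) (2 * p)]) \<in> carrier_mat (4 * p) (4 * p)"
proof -
  have "replicate 2 x = [x, x]" by (simp add: numeral_2_eq_2)
  thus ?thesis using assms by (intro carrier_matI) (auto simp: dim_diag_block_mat)
qed

text \<open>Cut at \<open>n\<close>, the words of the first quarter have empty tail and those of the
  second have tail \<open>[int n + 1]\<close>; the operator acts by \<open>x\<close> on each and
  keeps the tail. In the remaining rows the image vanishes.\<close>

lemma operator_matrix_Suc_matrix_operator:
  assumes x: "x \<in> carrier_mat (block_dim n) (block_dim n)"
  shows "operator_matrix (Suc n) (matrix_operator n x) =
    diag_block_mat (replicate 2 x @ [0\<^sub>m (2 * block_dim n) (2 * block_dim n)])" (is "?l = ?r")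
proof (rule eq_matI)
  let ?d = "block_dim n" and ?L = "block_words n" and ?M = "block_words (Suc n)"
  have dims: "dim_row ?r = 4 * ?d" "dim_col ?r = 4 * ?d"
    using diag_block_mat_two_zero_carrier[OF x] by auto
  show "dim_row ?l = dim_row ?r" "dim_col ?l = dim_col ?r"
    unfolding dims by (simp_all add: operator_matrix_def block_dim_Suc)
  fix i j assume "i < dim_row ?r" "j < dim_col ?r"
  hence i: "i < 4 * ?d" and j: "j < 4 * ?d" using dims by auto
  have r: "?r $$ (i, j) = (if i < ?d then if j < ?d then x $$ (i, j) else 0
      else if i < 2 * ?d \<and> ?d \<le> j \<and> j < 2 * ?d then x $$ (i - ?d, j - ?d) else 0)"
    by (rule index_diag_block_mat_two_zero[OF x i j])
  define e where "e = ket (word (?M ! j))"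
  have l: "?l $$ (i, j) = coord (blinfun_apply (matrix_operator n x) e) (word (?M ! i))"
    using i j by (simp add: operator_matrix_def e_def block_dim_Suc)
  have e: "coord e (word (?M ! k)) = (if k = j then 1 else 0)" if "k < 4 * ?d" for k
    using that j block_wordsD(1)[of _ "Suc n"] unfolding e_def
    by (simp add: coord_ket_word nth_eq_iff_index_eq[OF distinct_block_words] block_dim_Suc
         )
  consider (first) "i < ?d" | (second) k where "k < ?d" "i = ?d + k" | (rest) "2 * ?d \<le> i"
  proof -
    have "i - ?d < ?d \<and> i = ?d + (i - ?d)" if "\<not> i < ?d" "\<not> 2 * ?d \<le> i"
      using that by arith
    thus thesis using that by blast
  qed
  thus "?l $$ (i, j) = ?r $$ (i, j)"
  proof cases
    case first
    have "?l $$ (i, j) = (\<Sum>k<?d. x $$ (i, k) * coord e (word (?M ! k)))"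
      unfolding l nth_block_words_Suc(1)[OF first]
      using coord_matrix_operator[OF first, of "[]" x e]
      by (simp add: nth_block_words_Suc(1))
    also have "\<dots> = (\<Sum>k<?d. if k = j then x $$ (i, k) else 0)"
      by (rule sum.cong) (auto simp: e)
    finally show ?thesis using first by (simp add: r)
  next
    case second
    have "?l $$ (i, j) = (\<Sum>m<?d. x $$ (k, m) * coord e (word (?M ! (?d + m))))"
      unfolding l unfolding second(2) nth_block_words_Suc(2)[OF second(1)]
      using coord_matrix_operator[OF second(1), of "[int n + 1]" x e]
      by (simp add: nth_block_words_Suc(2))
    also have "\<dots> = (\<Sum>m<?d. if ?d + m = j then x $$ (k, m) else 0)"
      by (rule sum.cong) (auto simp: e)
    \<comment> \<open>Subtraction is truncated: the guard \<open>?d \<le> j\<close> excludes the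
      false solution \<open>m = 0\<close> when \<open>j < ?d\<close>.\<close>
    also have "\<dots> = (\<Sum>m<?d. if m = j - ?d then (if ?d \<le> j then x $$ (k, m) else 0) else 0)"
      by (rule sum.cong) auto
    finally show ?thesis unfolding r unfolding second(2) using second(1) by auto
  next
    case rest
    then obtain v where v: "v \<in> set ?L"
      and "?M ! i = (- int n - 1) # v \<or> ?M ! i = (- int n - 1) # v @ [int n + 1]"
      using nth_block_words_Suc(3) i by blast
    \<comment> \<open>A final letter \<open>int n + 1\<close>, if present, is the tail; the prefix
      starts with \<open>- int n - 1\<close> and hence lies outside the block of level
      \<open>n\<close>.\<close>
    then obtain y where y: "?M ! i = ((- int n - 1) # v) @ y" "\<forall>k\<in>set y. int n < k"
    proof (elim disjE)
    assume "?M ! i = (- int n - 1) # v" thus thesis by (intro that[of "[]"]) simp_all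
  next
    assume "?M ! i = (- int n - 1) # v @ [int n + 1]"
    thus thesis by (intro that[of "[int n + 1]"]) simp_all
  qed
    have "?M ! i \<in> set ?M" using i by (intro nth_mem) (simp only: block_dim_Suc)
    hence s: "sorted_wrt (<) (((- int n - 1) # v) @ y)" using block_wordsD(1) y(1) by metis
    have "(- int n - 1) # v \<notin> set ?L" by (auto simp: set_block_words)
    from coord_matrix_operator_outside[OF s _ y(2) this]
    have "?l $$ (i, j) = 0" unfolding l y(1) using block_wordsD(2)[OF v] by auto
    thus ?thesis using rest by (simp add: r)
  qed
qed

lemma unitary_matrix_one: "unitary_matrix q (1\<^sub>m q)" "mat_adjoint (1\<^sub>m q) = (1\<^sub>m q :: complex mat)"
proof -
  show a: "mat_adjoint (1\<^sub>m q) = (1\<^sub>m q :: complex mat)"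
    by (rule eq_matI) (auto simp: index_mat_adjoint)
  show "unitary_matrix q (1\<^sub>m q)"
    unfolding unitary_matrix_def a by simp
qed

text \<open>The \<open>inv_into\<close> is \<open>matrix_operator n\<close>, so the map is the
  direct sum computed in \<open>operator_matrix_Suc_matrix_operator\<close>, with a zero block of
  size \<open>4 d - 2 d = 2 d\<close> for \<open>d = block_dim n\<close>.\<close>

lemma has_multiplicity_inclusion:
  "has_multiplicity (block_dim n) (block_dim (Suc n)) 2
     (\<lambda>x. operator_matrix (Suc n) (inv_into (\<BB> n) (operator_matrix n) x))"
  unfolding has_multiplicity_def block_dim_Suc
proof (intro conjI exI[of _ "1\<^sub>m (4 * block_dim n)"] ballI unitary_matrix_one)
  fix x :: "complex mat" assume x: "x \<in> carrier_mat (block_dim n) (block_dim n)"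
  have "inv_into (\<BB> n) (operator_matrix n) x = matrix_operator n x"
    using x bij_betw_operator_matrix[of n]
    by (intro inv_into_f_eq)
       (auto simp: bij_betw_def monotone_B_eq block_algebra_def operator_matrix_matrix_operator)
  moreover have "4 * block_dim n - 2 * block_dim n = 2 * block_dim n" by simp
  moreover have "diag_block_mat (replicate 2 x @ [0\<^sub>m (2 * block_dim n) (2 * block_dim n)])
      \<in> carrier_mat (4 * block_dim n) (4 * block_dim n)"
    using x by (rule diag_block_mat_two_zero_carrier)
  ultimately show "operator_matrix (Suc n) (inv_into (\<BB> n) (operator_matrix n) x) =
      1\<^sub>m (4 * block_dim n) * diag_block_mat (replicate 2 x @
        [0\<^sub>m (4 * block_dim n - 2 * block_dim n) (4 * block_dim n - 2 * block_dim n)])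
      * mat_adjoint (1\<^sub>m (4 * block_dim n))"
    unfolding unitary_matrix_one(2)
    by (simp only: operator_matrix_Suc_matrix_operator[OF x] left_mult_one_mat right_mult_one_mat)
qed simp

theorem theorem3p8:
  shows "bratteli_single \<II> \<BB> (\<lambda>n. 2 ^ (2 * n + 1)) (\<lambda>n. 2)"
  \<comment> \<open>The powers of 2 are rewritten as \<open>block_dim n\<close>, the form in which
    the isomorphisms and inclusions were established.\<close>
  unfolding bratteli_single_def length_block_words[symmetric]
proof (intro conjI allI exI[of _ operator_matrix])
  show "cstar_subalgebra \<II>" unfolding monotone_I_eq by (rule cstar_subalgebra_closure_Union)
qed (simp_all add: cstar_subalgebra_monotone_B monotone_B_mono monotone_I_eq
       matrix_isomorphism_operator_matrix has_multiplicity_inclusion)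

end
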